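(* There is a complete type $p(x)\in S_1(T)$ (over $\emptyset$) such that the set $\operatorname{Mod}(p(a))\subseteq2^\omega$ is $\mathbf\Pi^0_\omega$-hard. In particular, $p(a)$ is not $\forall_n$-axiomatizable for any finite $n$.
   Context: Let $\mathcal L_0=\{P_i: i\in\omega\}\cup\{<_i:i\in\omega\}$ with $P_i$ unary and $<_i$ binary relation symbols. $T_0$ is the $\mathcal L_0$-theory with axioms: for all $i\neq j$, $P_i\cap P_j=\emptyset$; for all $i$: $<_i\subseteq P_i\times P_{i+1}$; $\forall x\in P_{i+1}\,\exists y\in P_i\,(y<_i x)$; $\forall x\forall x'\forall y((x<_i y\wedge x'<_i y)\to x=x')$. Let $(\mathcal M_i)_{i<\omega}$ list without repetition representatives of all isomorphism types of finite models of $T_0$. For $i,j\in\omega$ let $C_i^j$ be a set of $|M_i|$ new constant symbols (pairwise disjoint sets), with a fixed bijection $e_i^j:C_i^j\to M_i$; let $C=\bigcup_{i,j}C_i^j$ and $\tilde{\mathcal L}=\mathcal L_0\cup C$. $T$ consists of: $T_0$; $c\neq d$ for distinct $c,d\in C$; for each $i,j$ the atomic and negated atomic $\mathcal L_0$-sentences making the substructure on $C_i^j$ isomorphic to $\mathcal M_i$ via $e_i^j$; and for each $i,j,k$: $\forall x\forall y\big((\bigvee_{c\in C_i^j}x=c)\wedge(x<_k y\vee y<_k x)\to\bigvee_{c\in C_i^j}y=c\big)$. ($T$ is complete.) Here $a$ is a new constant symbol, and $\operatorname{Mod}(p(a))$ is the set of (atomic diagrams in $2^\omega$, via a fixed enumeration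 of atomic sentences with constants from $\omega$, of) $\tilde{\mathcal L}\cup\{a\}$-structures with domain $\omega$ satisfying $p(a)$. A set $S\subseteq2^\omega$ is $\mathbf\Pi^0_\omega$ if for some oracle $X$ it equals $\bigcap_{0<i<\omega}S_i$ with $S_i$ uniformly $\Sigma^0_i(X)$; a set $B$ is $\mathbf\Pi^0_\omega$-hard if for every $\mathbf\Pi^0_\omega$ set $S$ there is a continuous $f:2^\omega\to2^\omega$ with $f^{-1}(B)=S$. A $\forall_n$-formula is defined inductively: $\forall_0=\exists_0$ are quantifier-free formulas; $\forall_{n+1}$ ($\exists_{n+1}$) formulas are blocks of universal (existential) quantifiers followed by an $\exists_n$ ($\forall_n$) formula; a theory is $\forall_n$-axiomatizable if it has an axiomatization by $\forall_n$-sentences. *)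

theory Defs
  imports "HOL-Analysis.Analysis" "HOL-Library.Nat_Bijection"
begin

section \<open>First-order logic with unary \<open>P\<^sub>i\<close>, binary \<open><\<^sub>i\<close>, and constants\<close>

text \<open>
  A language is \<open>L\<^sub>0\<close> together with a set \<open>K :: 'k set\<close> of constant symbols; \<open>L\<^sub>0\<close> itself is
  \<open>K = {}\<close>. Formulas and structures are typed over all of \<open>'k\<close>, and \<open>K\<close> is imposed separately:
  what a structure assigns to constants outside \<open>K\<close> is junk that formulas over \<open>K\<close> never see.
\<close>

datatype 'k tm = Var nat | Cst 'k

datatype (csts: 'k) fm =
    Bot
  | Eq "'k tm" "'k tm"
  | Pr nat "'k tm"
  | Lt nat "'k tm" "'k tm"
  | Neg "'k fm"
  | Conj "'k fm" "'k fm"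
  | Disj "'k fm" "'k fm"
  | All nat "'k fm"
  | Ex nat "'k fm"

abbreviation Imp :: "'k fm \<Rightarrow> 'k fm \<Rightarrow> 'k fm" where
  "Imp \<phi> \<psi> \<equiv> Disj (Neg \<phi>) \<psi>"

primrec tm_vars :: "'k tm \<Rightarrow> nat set" where
  "tm_vars (Var x) = {x}"
| "tm_vars (Cst c) = {}"

primrec fv :: "'k fm \<Rightarrow> nat set" where
  "fv Bot = {}"
| "fv (Eq s t) = tm_vars s \<union> tm_vars t"
| "fv (Pr i t) = tm_vars t"
| "fv (Lt i s t) = tm_vars s \<union> tm_vars t"
| "fv (Neg \<phi>) = fv \<phi>"
| "fv (Conj \<phi> \<psi>) = fv \<phi> \<union> fv \<psi>"
| "fv (Disj \<phi> \<psi>) = fv \<phi> \<union> fv \<psi>"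
| "fv (All x \<phi>) = fv \<phi> - {x}"
| "fv (Ex x \<phi>) = fv \<phi> - {x}"

definition sentences :: "'k set \<Rightarrow> 'k fm set" where
  "sentences K = {\<phi>. csts \<phi> \<subseteq> K \<and> fv \<phi> = {}}"

primrec inst_tm :: "nat \<Rightarrow> 'k \<Rightarrow> 'k tm \<Rightarrow> 'k tm" where
  "inst_tm x c (Var y) = (if y = x then Cst c else Var y)"
| "inst_tm x c (Cst d) = Cst d"

text \<open>\<open>\<phi>(c)\<close>: the constant \<open>c\<close> replaces the free occurrences of the variable \<open>x\<close>.\<close>

primrec inst :: "nat \<Rightarrow> 'k \<Rightarrow> 'k fm \<Rightarrow> 'k fm" where
  "inst x c Bot = Bot"
| "inst x c (Eq s t) = Eq (inst_tm x c s) (inst_tm x c t)"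
| "inst x c (Pr i t) = Pr i (inst_tm x c t)"
| "inst x c (Lt i s t) = Lt i (inst_tm x c s) (inst_tm x c t)"
| "inst x c (Neg \<phi>) = Neg (inst x c \<phi>)"
| "inst x c (Conj \<phi> \<psi>) = Conj (inst x c \<phi>) (inst x c \<psi>)"
| "inst x c (Disj \<phi> \<psi>) = Disj (inst x c \<phi>) (inst x c \<psi>)"
| "inst x c (All y \<phi>) = All y (if y = x then \<phi> else inst x c \<phi>)"
| "inst x c (Ex y \<phi>) = Ex y (if y = x then \<phi> else inst x c \<phi>)"

record ('k, 'u) struct =
  univ :: "'u set"
  rP :: "nat \<Rightarrow> 'u \<Rightarrow> bool"
  rL :: "nat \<Rightarrow> 'u \<Rightarrow> 'u \<Rightarrow> bool"
  cst :: "'k \<Rightarrow> 'u"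

definition is_struct :: "'k set \<Rightarrow> ('k, 'u) struct \<Rightarrow> bool" where
  "is_struct K N \<longleftrightarrow> univ N \<noteq> {} \<and> (\<forall>c\<in>K. cst N c \<in> univ N)"

primrec tval :: "('k, 'u) struct \<Rightarrow> (nat \<Rightarrow> 'u) \<Rightarrow> 'k tm \<Rightarrow> 'u" where
  "tval N v (Var x) = v x"
| "tval N v (Cst c) = cst N c"

primrec sat :: "('k, 'u) struct \<Rightarrow> (nat \<Rightarrow> 'u) \<Rightarrow> 'k fm \<Rightarrow> bool" where
  "sat N v Bot \<longleftrightarrow> False"
| "sat N v (Eq s t) \<longleftrightarrow> tval N v s = tval N v t"
| "sat N v (Pr i t) \<longleftrightarrow> rP N i (tval N v t)"
| "sat N v (Lt i s t) \<longleftrightarrow> rL N i (tval N v s) (tval N v t)"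
| "sat N v (Neg \<phi>) \<longleftrightarrow> \<not> sat N v \<phi>"
| "sat N v (Conj \<phi> \<psi>) \<longleftrightarrow> sat N v \<phi> \<and> sat N v \<psi>"
| "sat N v (Disj \<phi> \<psi>) \<longleftrightarrow> sat N v \<phi> \<or> sat N v \<psi>"
| "sat N v (All x \<phi>) \<longleftrightarrow> (\<forall>u\<in>univ N. sat N (v(x := u)) \<phi>)"
| "sat N v (Ex x \<phi>) \<longleftrightarrow> (\<exists>u\<in>univ N. sat N (v(x := u)) \<phi>)"

text \<open>Used for sentences only, where the quantification over assignments is immaterial.\<close>

definition holds :: "('k, 'u) struct \<Rightarrow> 'k fm \<Rightarrow> bool" where
  "holds N \<phi> \<longleftrightarrow> (\<forall>v. range v \<subseteq> univ N \<longrightarrow> sat N v \<phi>)"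

definition models :: "('k, 'u) struct \<Rightarrow> 'k fm set \<Rightarrow> bool" where
  "models N \<Gamma> \<longleftrightarrow> (\<forall>\<phi>\<in>\<Gamma>. holds N \<phi>)"

definition iso_L0 :: "('k, 'u) struct \<Rightarrow> ('l, 'w) struct \<Rightarrow> bool" where
  "iso_L0 N N' \<longleftrightarrow> (\<exists>h. bij_betw h (univ N) (univ N')
     \<and> (\<forall>i. \<forall>x\<in>univ N. rP N' i (h x) \<longleftrightarrow> rP N i x)
     \<and> (\<forall>i. \<forall>x\<in>univ N. \<forall>y\<in>univ N. rL N' i (h x) (h y) \<longleftrightarrow> rL N i x y))"

fun atomic :: "'k fm \<Rightarrow> bool" where
  "atomic (Eq s t) = True"
| "atomic (Pr i t) = True"
| "atomic (Lt i s t) = True"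
| "atomic _ = False"

definition atomic_sentences :: "'k set \<Rightarrow> 'k fm set" where
  "atomic_sentences K = {\<phi> \<in> sentences K. atomic \<phi>}"


section \<open>The hierarchy of \<open>\<forall>\<^sub>n\<close>-formulas\<close>

primrec qfree :: "'k fm \<Rightarrow> bool" where
  "qfree Bot = True"
| "qfree (Eq s t) = True"
| "qfree (Pr i t) = True"
| "qfree (Lt i s t) = True"
| "qfree (Neg \<phi>) = qfree \<phi>"
| "qfree (Conj \<phi> \<psi>) = (qfree \<phi> \<and> qfree \<psi>)"
| "qfree (Disj \<phi> \<psi>) = (qfree \<phi> \<and> qfree \<psi>)"
| "qfree (All x \<phi>) = False"
| "qfree (Ex x \<phi>) = False"

text \<open>Quantifier blocks are finite and may be empty, so the hierarchy is cumulative.\<close>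

fun forall_fms :: "nat \<Rightarrow> 'k fm set" and exists_fms :: "nat \<Rightarrow> 'k fm set" where
  "forall_fms 0 = {\<phi>. qfree \<phi>}"
| "exists_fms 0 = {\<phi>. qfree \<phi>}"
| "forall_fms (Suc n) = {foldr All xs \<psi> | xs \<psi>. \<psi> \<in> exists_fms n}"
| "exists_fms (Suc n) = {foldr Ex xs \<psi> | xs \<psi>. \<psi> \<in> forall_fms n}"

text \<open>
  Axiomatizing means having the same models. Comparing models whose universe is a nonempty set of
  naturals loses nothing for a countable set \<open>K\<close> of constants, by downward Loewenheim-Skolem.
\<close>

definition forall_axiomatizable :: "nat \<Rightarrow> 'k set \<Rightarrow> 'k fm set \<Rightarrow> bool" where
  "forall_axiomatizable n K \<Theta> \<longleftrightarrow> (\<exists>\<Gamma> \<subseteq> sentences K \<inter> forall_fms n.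
     \<forall>N :: ('k, nat) struct. is_struct K N \<longrightarrow> (models N \<Gamma> \<longleftrightarrow> models N \<Theta>))"


section \<open>The theories \<open>T\<^sub>0\<close> and \<open>T\<close>\<close>

definition T0 :: "'k fm set" where
  "T0 =
     {All 0 (Neg (Conj (Pr i (Var 0)) (Pr j (Var 0)))) | i j. i \<noteq> j}
   \<union> {All 0 (All 1 (Imp (Lt i (Var 0) (Var 1)) (Conj (Pr i (Var 0)) (Pr (Suc i) (Var 1))))) | i. True}
   \<union> {All 0 (Imp (Pr (Suc i) (Var 0)) (Ex 1 (Conj (Pr i (Var 1)) (Lt i (Var 1) (Var 0))))) | i. True}
   \<union> {All 0 (All 1 (All 2
        (Imp (Conj (Lt i (Var 0) (Var 2)) (Lt i (Var 1) (Var 2))) (Eq (Var 0) (Var 1))))) | i. True}"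

definition finite_T0_model :: "('k, 'u) struct \<Rightarrow> bool" where
  "finite_T0_model N \<longleftrightarrow> is_struct {} N \<and> finite (univ N) \<and> models N T0"

text \<open>
  The \<open>M i\<close> are treated as \<open>L\<^sub>0\<close>-structures, their \<open>cst\<close> field being ignored. Every finite
  structure has an isomorphic copy on a set of naturals, so it suffices to list those.
\<close>

definition lists_finite_T0_models :: "(nat \<Rightarrow> ('k, 'u) struct) \<Rightarrow> bool" where
  "lists_finite_T0_models M \<longleftrightarrow>
     (\<forall>i. finite_T0_model (M i))
   \<and> (\<forall>i j. iso_L0 (M i) (M j) \<longrightarrow> i = j)
   \<and> (\<forall>N :: ('k, nat) struct. finite_T0_model N \<longrightarrow> (\<exists>i. iso_L0 N (M i)))"

definition literals_true_in :: "'k set \<Rightarrow> ('k, 'u) struct \<Rightarrow> 'k fm set" where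
  "literals_true_in K N =
     {\<phi> \<in> atomic_sentences K. holds N \<phi>} \<union> {Neg \<phi> | \<phi>. \<phi> \<in> atomic_sentences K \<and> \<not> holds N \<phi>}"

definition one_of :: "'k list \<Rightarrow> 'k tm \<Rightarrow> 'k fm" where
  "one_of cs t = foldr (\<lambda>c \<phi>. Disj (Eq t (Cst c)) \<phi>) cs Bot"

definition all_csts :: "(nat \<Rightarrow> nat \<Rightarrow> 'k set) \<Rightarrow> 'k set" where
  "all_csts C = (\<Union>i j. C i j)"

text \<open>
  The finite disjunction over \<open>C i j\<close> needs an order of the constants. Instead of choosing one, the
  last line below has an axiom for each order, and these axioms are logically equivalent.
\<close>

definition theory_T ::
  "(nat \<Rightarrow> ('k, 'u) struct) \<Rightarrow> (nat \<Rightarrow> nat \<Rightarrow> 'k set) \<Rightarrow> (nat \<Rightarrow> nat \<Rightarrow> 'k \<Rightarrow> 'u) \<Rightarrow> 'k fm set" where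
  "theory_T M C e =
     T0
   \<union> {Neg (Eq (Cst c) (Cst d)) | c d. c \<in> all_csts C \<and> d \<in> all_csts C \<and> c \<noteq> d}
   \<union> (\<Union>i j. literals_true_in (C i j) ((M i)\<lparr>cst := e i j\<rparr>))
   \<union> {All 0 (All 1 (Imp
        (Conj (one_of cs (Var 0)) (Disj (Lt k (Var 0) (Var 1)) (Lt k (Var 1) (Var 0))))
        (one_of cs (Var 1)))) | i j k cs. distinct cs \<and> set cs = C i j}"


section \<open>Types and sets of models\<close>

text \<open>
  The free variable of a 1-type is \<open>Var 0\<close>. Consistency is satisfiability, with a universe inside
  the naturals; for countable \<open>K\<close> this is no restriction, again by Loewenheim-Skolem.
\<close>

definition complete_1_types :: "'k set \<Rightarrow> 'k fm set \<Rightarrow> 'k fm set set" where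
  "complete_1_types K T = {p.
     p \<subseteq> {\<phi>. csts \<phi> \<subseteq> K \<and> fv \<phi> \<subseteq> {0}}
   \<and> (\<exists>(N :: ('k, nat) struct) v. is_struct K N \<and> range v \<subseteq> univ N \<and> (\<forall>\<phi> \<in> T \<union> p. sat N v \<phi>))
   \<and> (\<forall>\<phi>. csts \<phi> \<subseteq> K \<and> fv \<phi> \<subseteq> {0} \<longrightarrow> \<phi> \<in> p \<or> Neg \<phi> \<in> p)}"

definition type_at :: "'k fm set \<Rightarrow> 'k \<Rightarrow> 'k fm set" where
  "type_at p a = inst 0 a ` p"

text \<open>A structure on \<open>\<omega>\<close> with a name \<open>Inr n\<close> for each element \<open>n\<close>.\<close>

definition name_elements :: "('k, nat) struct \<Rightarrow> ('k + nat, nat) struct" where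
  "name_elements N = \<lparr>univ = univ N, rP = rP N, rL = rL N, cst = case_sum (cst N) id\<rparr>"

definition enumerates_atomic_sentences :: "(nat \<Rightarrow> ('k + nat) fm) \<Rightarrow> 'k set \<Rightarrow> bool" where
  "enumerates_atomic_sentences enum K \<longleftrightarrow> range enum = atomic_sentences (Inl ` K \<union> range Inr)"

definition atomic_diagram :: "(nat \<Rightarrow> ('k + nat) fm) \<Rightarrow> ('k, nat) struct \<Rightarrow> nat \<Rightarrow> bool" where
  "atomic_diagram enum N = (\<lambda>n. holds (name_elements N) (enum n))"

definition Mod ::
  "(nat \<Rightarrow> ('k + nat) fm) \<Rightarrow> 'k set \<Rightarrow> 'k fm set \<Rightarrow> (nat \<Rightarrow> bool) set" where
  "Mod enum K \<Theta> = atomic_diagram enum ` {N. is_struct K N \<and> univ N = UNIV \<and> models N \<Theta>}"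


section \<open>Computability relative to an oracle, and \<open>\<Pi>\<^sup>0\<^sub>\<omega>\<close> sets\<close>

text \<open>Partial recursive functions with an oracle \<open>X\<close>.\<close>

datatype prog =
  Zero | Succ | Proj nat | Query | Comp prog "prog list" | PrimRec prog prog | Mu prog

inductive computes :: "(nat \<Rightarrow> bool) \<Rightarrow> prog \<Rightarrow> nat list \<Rightarrow> nat \<Rightarrow> bool" for X where
  zero: "computes X Zero xs 0"
| succ: "computes X Succ [x] (Suc x)"
| proj: "i < length xs \<Longrightarrow> computes X (Proj i) xs (xs ! i)"
| query: "computes X Query [x] (of_bool (X x))"
| comp: "list_all2 (\<lambda>g y. computes X g xs y) gs ys \<Longrightarrow> computes X f ys z
    \<Longrightarrow> computes X (Comp f gs) xs z"
| rec_zero: "computes X f xs z \<Longrightarrow> computes X (PrimRec f g) (0 # xs) z"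
| rec_suc: "computes X (PrimRec f g) (n # xs) y \<Longrightarrow> computes X g (y # n # xs) z
    \<Longrightarrow> computes X (PrimRec f g) (Suc n # xs) z"
| mu: "computes X f (n # xs) 0 \<Longrightarrow> (\<forall>m<n. \<exists>y. computes X f (m # xs) (Suc y))
    \<Longrightarrow> computes X (Mu f) xs n"

definition computable_in :: "(nat \<Rightarrow> bool) \<Rightarrow> (nat \<Rightarrow> bool) \<Rightarrow> bool" where
  "computable_in X R \<longleftrightarrow> (\<exists>e. \<forall>m. computes X e [m] (of_bool (R m)))"

text \<open>\<open>alternating True n Q\<close> is \<open>\<exists>k\<^sub>1 \<forall>k\<^sub>2 \<exists>k\<^sub>3 \<dots> Q [k\<^sub>1, \<dots>, k\<^sub>n]\<close>, with \<open>n\<close> quantifiers.\<close>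

primrec alternating :: "bool \<Rightarrow> nat \<Rightarrow> (nat list \<Rightarrow> bool) \<Rightarrow> bool" where
  "alternating b 0 Q = Q []"
| "alternating b (Suc n) Q =
     (if b then \<exists>k. alternating (\<not> b) n (\<lambda>ks. Q (k # ks))
      else \<forall>k. alternating (\<not> b) n (\<lambda>ks. Q (k # ks)))"

text \<open>The code of the finite string \<open>f(0) \<dots> f(k - 1)\<close>.\<close>

definition restr_code :: "(nat \<Rightarrow> bool) \<Rightarrow> nat \<Rightarrow> nat" where
  "restr_code f k = list_encode (map (\<lambda>m. of_bool (f m)) [0..<k])"

text \<open>
  A class is \<open>\<Sigma>\<^sup>0\<^sub>i(X)\<close> if it is \<open>{f. \<exists>k\<^sub>1 \<forall>k\<^sub>2 \<dots> R (f\<restriction>k\<^sub>1, \<dots>, f\<restriction>k\<^sub>i)}\<close> for some relation \<open>R\<close> computable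
  in \<open>X\<close>. Uniformity in \<open>i\<close> means that one \<open>R\<close>, with \<open>i\<close> as an additional argument, serves all \<open>i\<close>.
\<close>

definition uniformly_Sigma :: "(nat \<Rightarrow> bool) \<Rightarrow> (nat \<Rightarrow> (nat \<Rightarrow> bool) set) \<Rightarrow> bool" where
  "uniformly_Sigma X S \<longleftrightarrow> (\<exists>R. computable_in X R \<and>
     (\<forall>i>0. S i = {f. alternating True i (\<lambda>ks. R (list_encode (i # map (restr_code f) ks)))}))"

definition Pi0_omega :: "(nat \<Rightarrow> bool) set \<Rightarrow> bool" where
  "Pi0_omega B \<longleftrightarrow> (\<exists>X S. uniformly_Sigma X S \<and> B = (\<Inter>i\<in>{0<..}. S i))"

text \<open>
  Continuity refers to the library's product topology on functions into the discrete \<open>bool\<close>, i.e. to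
  Cantor space.
\<close>

definition Pi0_omega_hard :: "(nat \<Rightarrow> bool) set \<Rightarrow> bool" where
  "Pi0_omega_hard B \<longleftrightarrow> (\<forall>S. Pi0_omega S \<longrightarrow>
     (\<exists>f :: (nat \<Rightarrow> bool) \<Rightarrow> (nat \<Rightarrow> bool). continuous_on UNIV f \<and> f -` B = S))"

end

(*
  An n-fold alternation EX k1 ALL k2 ... is coded by a tree of height n: a node of level m + 1 is
  true if it has a child of level m that is false. After padding, so that true children, and
  false ones if there are any, occur infinitely often, the isomorphism type of such a tree only
  depends on n and on its truth value. Let a be a root with one such tree for every n, beside the
  named finite models, and let p be the type of a when all these trees are true. Truth of the n-th
  tree is expressible at a, so a realizes p iff all the trees are true. Since the diagram of the
  structure depends continuously on the matrices of the alternations, p(a) is hard.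

  If p(a) had a universal-existential axiomatization with n blocks, then the failure of the
  alternation with m = n + 2 quantifiers, in dependence on its matrix q, would be Sigma_m, that is,
  equivalent to the value of a matrix T(q) with T continuous. Delaying T along the last quantifier
  makes it have a fixed point up to truth value, which is a contradiction.
*)
theory Submission
  imports Defs
begin

section \<open>Satisfaction\<close>

lemma tval_cong: "(\<And>x. x \<in> tm_vars t \<Longrightarrow> v x = w x) \<Longrightarrow> tval N v t = tval N w t"
  by (cases t) auto

lemma sat_cong_fv: "(\<And>x. x \<in> fv \<phi> \<Longrightarrow> v x = w x) \<Longrightarrow> sat N v \<phi> = sat N w \<phi>"
proof (induction \<phi> arbitrary: v w)
  case (Eq s t)
  then show ?case using tval_cong[of s v w N] tval_cong[of t v w N] by simp
next
  case (Pr i t)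
  then show ?case using tval_cong[of t v w N] by simp
next
  case (Lt i s t)
  then show ?case using tval_cong[of s v w N] tval_cong[of t v w N] by simp
next
  case (Conj \<phi>1 \<phi>2)
  have "sat N v \<phi>1 = sat N w \<phi>1" "sat N v \<phi>2 = sat N w \<phi>2"
    using Conj.prems by (auto intro!: Conj.IH)
  then show ?case by simp
next
  case (Disj \<phi>1 \<phi>2)
  have "sat N v \<phi>1 = sat N w \<phi>1" "sat N v \<phi>2 = sat N w \<phi>2"
    using Disj.prems by (auto intro!: Disj.IH)
  then show ?case by simp
next
  case (All x \<phi>)
  have "sat N (v(x := u)) \<phi> = sat N (w(x := u)) \<phi>" for u
    using All.prems by (auto intro!: All.IH)
  then show ?case by simp
next
  case (Ex x \<phi>)
  have "sat N (v(x := u)) \<phi> = sat N (w(x := u)) \<phi>" for u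
    using Ex.prems by (auto intro!: Ex.IH)
  then show ?case by simp
next
  case (Neg \<phi>)
  have "sat N v \<phi> = sat N w \<phi>"
    by (rule Neg.IH) (simp add: Neg.prems)
  then show ?case by simp
qed simp

lemma holds_sentence:
  assumes "fv \<phi> = {}" "range v \<subseteq> univ N"
  shows "holds N \<phi> \<longleftrightarrow> sat N v \<phi>"
proof -
  have "sat N w \<phi> = sat N v \<phi>" for w
    by (rule sat_cong_fv) (simp add: assms(1))
  then show ?thesis using assms(2) by (auto simp: holds_def)
qed

lemma tval_inst: "tval N v (inst_tm x c t) = tval N (v(x := cst N c)) t"
  by (cases t) auto

lemma sat_inst: "sat N v (inst x c \<phi>) = sat N (v(x := cst N c)) \<phi>"
proof (induction \<phi> arbitrary: v)
  case (All y \<phi>)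
  show ?case
  proof (cases "y = x")
    case False
    then have "sat N (v(y := u)) (inst x c \<phi>) = sat N (v(x := cst N c, y := u)) \<phi>" for u
      by (subst All.IH, subst fun_upd_twist) auto
    with False show ?thesis by (simp add: fun_upd_def)
  qed (simp add: fun_upd_def cong: if_cong)
next
  case (Ex y \<phi>)
  show ?case
  proof (cases "y = x")
    case False
    then have "sat N (v(y := u)) (inst x c \<phi>) = sat N (v(x := cst N c, y := u)) \<phi>" for u
      by (subst Ex.IH, subst fun_upd_twist) auto
    with False show ?thesis by (simp add: fun_upd_def)
  qed (simp add: fun_upd_def cong: if_cong)
qed (simp_all add: tval_inst)

lemma fv_inst_tm: "tm_vars (inst_tm x c t) = tm_vars t - {x}"
  by (cases t) auto

lemma fv_inst: "fv (inst x c \<phi>) = fv \<phi> - {x}"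
  by (induction \<phi>) (auto simp: fv_inst_tm)

lemma models_type_at:
  assumes "p \<subseteq> {\<phi>. csts \<phi> \<subseteq> K \<and> fv \<phi> \<subseteq> {0}}" "is_struct {a} N"
  shows "models N (type_at p a) \<longleftrightarrow> (\<forall>\<phi>\<in>p. sat N (\<lambda>_. cst N a) \<phi>)"
proof -
  have "holds N (inst 0 a \<phi>) \<longleftrightarrow> sat N (\<lambda>_. cst N a) \<phi>" if "\<phi> \<in> p" for \<phi>
  proof -
    have "fv (inst 0 a \<phi>) = {}"
      using that assms(1) by (auto simp: fv_inst)
    moreover have "range (\<lambda>_::nat. cst N a) \<subseteq> univ N"
      using assms(2) by (auto simp: is_struct_def)
    ultimately show ?thesis
      using holds_sentence[of "inst 0 a \<phi>" "\<lambda>_. cst N a" N] by (simp add: sat_inst fun_upd_idem)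
  qed
  then show ?thesis by (auto simp: models_def type_at_def)
qed

text \<open>Only the constants in \<open>\<phi>\<close> have to be respected, since others may carry
  junk values. Serves for tree automorphisms, for copies on the natural numbers and, with the
  identity as \<open>h\<close>, for structures with the same diagram.\<close>

lemma sat_iso:
  assumes h: "bij_betw h (univ N) (univ N')"
    and P: "\<And>i x. x \<in> univ N \<Longrightarrow> rP N' i (h x) = rP N i x"
    and L: "\<And>i x y. x \<in> univ N \<Longrightarrow> y \<in> univ N \<Longrightarrow> rL N' i (h x) (h y) = rL N i x y"
    and c: "\<And>c. c \<in> csts \<phi> \<Longrightarrow> cst N c \<in> univ N \<and> cst N' c = h (cst N c)"
    and v: "range v \<subseteq> univ N"
  shows "sat N' (\<lambda>x. h (v x)) \<phi> = sat N v \<phi>"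
  using c v
proof (induction \<phi> arbitrary: v)
  have t: "tval N v t \<in> univ N \<and> tval N' (\<lambda>x. h (v x)) t = h (tval N v t)"
    if "range v \<subseteq> univ N" "\<And>c. c \<in> set_tm t \<Longrightarrow> cst N c \<in> univ N \<and> cst N' c = h (cst N c)" for t v
    using that by (cases t) auto
  {
    case (Eq s t)
    then show ?case
      using t[of v s] t[of v t] h by (auto simp: bij_betw_def inj_on_def)
  next
    case (Pr i t)
    then show ?case using t[of v t] P by auto
  next
    case (Lt i s t)
    then show ?case using t[of v s] t[of v t] L by auto
  }
  have upd: "(\<lambda>y. h (if y = x then u else v y)) = (\<lambda>y. h (v y))(x := h u)" for v x u
    by auto
  have im: "univ N' = h ` univ N" using h by (simp add: bij_betw_def)
  {
    case (All x \<phi>)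
    have "sat N' ((\<lambda>y. h (v y))(x := h u)) \<phi> = sat N (v(x := u)) \<phi>" if "u \<in> univ N" for u
      using All.IH[of "v(x := u)"] All.prems that by (auto simp: upd fun_upd_def)
    then show ?case by (simp add: im)
  next
    case (Ex x \<phi>)
    have "sat N' ((\<lambda>y. h (v y))(x := h u)) \<phi> = sat N (v(x := u)) \<phi>" if "u \<in> univ N" for u
      using Ex.IH[of "v(x := u)"] Ex.prems that by (auto simp: upd fun_upd_def)
    then show ?case by (simp add: im)
  next
    case (Conj \<phi> \<psi>)
    show ?case using Conj.IH(1)[of v] Conj.IH(2)[of v] Conj.prems by simp
  next
    case (Disj \<phi> \<psi>)
    show ?case using Disj.IH(1)[of v] Disj.IH(2)[of v] Disj.prems by simp
  next
    case (Neg \<phi>)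
    show ?case using Neg.IH[of v] Neg.prems by simp
  }
qed simp

section \<open>Countability of the set of formulas\<close>

context
  fixes g :: "'k \<Rightarrow> nat"
begin

primrec tm_code :: "'k tm \<Rightarrow> nat" where
  "tm_code (Var x) = prod_encode (0, x)"
| "tm_code (Cst c) = prod_encode (1, g c)"

primrec fm_code :: "'k fm \<Rightarrow> nat" where
  "fm_code Bot = prod_encode (0, 0)"
| "fm_code (Eq s t) = prod_encode (1, prod_encode (tm_code s, tm_code t))"
| "fm_code (Pr i t) = prod_encode (2, prod_encode (i, tm_code t))"
| "fm_code (Lt i s t) = prod_encode (3, prod_encode (i, prod_encode (tm_code s, tm_code t)))"
| "fm_code (Neg \<phi>) = prod_encode (4, fm_code \<phi>)"
| "fm_code (Conj \<phi> \<psi>) = prod_encode (5, prod_encode (fm_code \<phi>, fm_code \<psi>))"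
| "fm_code (Disj \<phi> \<psi>) = prod_encode (6, prod_encode (fm_code \<phi>, fm_code \<psi>))"
| "fm_code (All x \<phi>) = prod_encode (7, prod_encode (x, fm_code \<phi>))"
| "fm_code (Ex x \<phi>) = prod_encode (8, prod_encode (x, fm_code \<phi>))"

lemma tm_code_inj:
  assumes "inj_on g K" "set_tm s \<subseteq> K" "set_tm t \<subseteq> K" "tm_code s = tm_code t"
  shows "s = t"
  using assms by (cases s; cases t) (auto simp: inj_on_def)

text \<open>The first components tell the constructors apart. Both formulas range over
  \<open>K\<close> because \<open>g\<close> is injective only there.\<close>

lemma fm_code_inj:
  assumes "inj_on g K" "csts \<phi> \<subseteq> K" "csts \<psi> \<subseteq> K" "fm_code \<phi> = fm_code \<psi>"
  shows "\<phi> = \<psi>"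
  using assms(2-4)
proof (induction \<phi> arbitrary: \<psi>)
  case Bot
  then show ?case by (cases \<psi>) simp_all
next
  case (Eq s t)
  then show ?case by (cases \<psi>) (auto intro!: tm_code_inj[OF assms(1)])
next
  case (Pr i t)
  then show ?case by (cases \<psi>) (auto intro!: tm_code_inj[OF assms(1)])
next
  case (Lt i s t)
  then show ?case by (cases \<psi>) (auto intro!: tm_code_inj[OF assms(1)])
next
  case (Neg \<phi>)
  show ?case using Neg.prems by (cases \<psi>) (auto intro!: Neg.IH)
next
  case (Conj \<phi>1 \<phi>2)
  show ?case using Conj.prems by (cases \<psi>) (auto intro!: Conj.IH)
next
  case (Disj \<phi>1 \<phi>2)
  show ?case using Disj.prems by (cases \<psi>) (auto intro!: Disj.IH)
next
  case (All x \<phi>)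
  show ?case using All.prems by (cases \<psi>) (auto intro!: All.IH)
next
  case (Ex x \<phi>)
  show ?case using Ex.prems by (cases \<psi>) (auto intro!: Ex.IH)
qed

end

lemma countable_fms:
  assumes "countable K"
  shows "countable {\<phi>. csts \<phi> \<subseteq> K}"
  by (rule countableI'[of "fm_code (to_nat_on K)"])
    (auto intro!: inj_onI fm_code_inj[OF inj_on_to_nat_on[OF assms]])

text \<open>An empty universe admits no assignment, which makes \<open>holds\<close> vacuous; this
  is the first disjunct.\<close>

lemma models_T0_iff:
  "models (N :: ('a, 'b) struct) T0 \<longleftrightarrow> univ N = {} \<or>
     (\<forall>i j. i \<noteq> j \<longrightarrow> (\<forall>x\<in>univ N. \<not> (rP N i x \<and> rP N j x)))
   \<and> (\<forall>i. \<forall>x\<in>univ N. \<forall>y\<in>univ N. rL N i x y \<longrightarrow> rP N i x \<and> rP N (Suc i) y)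
   \<and> (\<forall>i. \<forall>x\<in>univ N. rP N (Suc i) x \<longrightarrow> (\<exists>y\<in>univ N. rP N i y \<and> rL N i y x))
   \<and> (\<forall>i. \<forall>x\<in>univ N. \<forall>y\<in>univ N. \<forall>z\<in>univ N. rL N i x z \<and> rL N i y z \<longrightarrow> x = y)"
    (is "?L \<longleftrightarrow> _ \<or> ?R")
proof (cases "univ N = {}")
  case True
  then show ?thesis by (auto simp: models_def holds_def)
next
  case False
  then obtain u where u: "range (\<lambda>_::nat. u) \<subseteq> univ N" by auto
  have h: "holds N \<phi> \<longleftrightarrow> sat N (\<lambda>_. u) \<phi>" if "\<phi> \<in> T0" for \<phi>
    using that by (intro holds_sentence[OF _ u]) (auto simp: T0_def)
  have "?L \<longleftrightarrow> (\<forall>\<phi>\<in>T0. sat N (\<lambda>_. u) \<phi>)"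
    by (auto simp: models_def h)
  also have "\<dots> \<longleftrightarrow> ?R"
  proof -
    have ball: "(\<forall>\<phi>\<in>{f i | i. True}. X \<phi>) \<longleftrightarrow> (\<forall>i. X (f i))"
      for f :: "nat \<Rightarrow> 'a fm" and X
      by blast
    have ball2: "(\<forall>\<phi>\<in>{f i j | i j. i \<noteq> j}. X \<phi>) \<longleftrightarrow> (\<forall>i j. i \<noteq> j \<longrightarrow> X (f i j))"
      for f :: "nat \<Rightarrow> nat \<Rightarrow> 'a fm" and X
      by blast
    show ?thesis
      unfolding T0_def ball_Un ball ball2 sat.simps tval.simps conj_assoc
      by (intro arg_cong2[of _ _ _ _ "(\<and>)"]; auto)
  qed
  finally show ?thesis using False by simp
qed

section \<open>Alternating quantifiers as trees\<close>

primrec val :: "nat \<Rightarrow> (nat list \<Rightarrow> bool) \<Rightarrow> bool" where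
  "val 0 q = q []"
| "val (Suc m) q = (\<exists>k. \<not> val m (\<lambda>l. q (k # l)))"

text \<open>Negating at each level turns every quantifier into an existential one. The matrix
  collects one negation per level, hence the parity.\<close>

lemma alternating_val:
  "alternating True n Q = val n (\<lambda>l. Q l = even n)"
  "alternating False n Q = (\<not> val n (\<lambda>l. Q l = odd n))"
  by (induction n arbitrary: Q) auto

text \<open>The number of children of each value is then fixed by the value of the node, so that
  height and value are the only isomorphism invariants.\<close>

primrec saturated :: "nat \<Rightarrow> (nat list \<Rightarrow> bool) \<Rightarrow> bool" where
  "saturated 0 q = True"
| "saturated (Suc m) q =
     ((\<forall>k. saturated m (\<lambda>l. q (k # l)))
    \<and> infinite {k. val m (\<lambda>l. q (k # l))}
    \<and> ({k. \<not> val m (\<lambda>l. q (k # l))} = {} \<or> infinite {k. \<not> val m (\<lambda>l. q (k # l))}))"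

section \<open>Isomorphisms between saturated trees\<close>

lemma bij_nat_preserving_set:
  fixes A B :: "nat set"
  assumes "infinite A" "infinite B"
    and "- A = {} \<or> infinite (- A)" "- B = {} \<or> infinite (- B)" "- A = {} \<longleftrightarrow> - B = {}"
  obtains f where "bij f" "\<And>k. f k \<in> B \<longleftrightarrow> k \<in> A"
proof -
  have ex: "\<exists>f. bij_betw f X Y" if "infinite X" "infinite Y" for X Y :: "nat set"
    using bij_betw_trans[OF to_nat_on_infinite[of X] bij_betw_from_nat_into[of Y]] that by auto
  obtain f where f: "bij_betw f A B" using ex[OF assms(1,2)] by auto
  obtain g where g: "bij_betw g (- A) (- B)"
    using ex[of "- A" "- B"] assms(3-5) bij_betw_empty1 by (cases "- A = {}") (auto simp: bij_betw_def)
  define h where "h k = (if k \<in> A then f k else g k)" for k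
  have "bij_betw h A B" "bij_betw h (- A) (- B)"
    using f g bij_betw_cong[of A f h B] bij_betw_cong[of "- A" g h "- B"] by (auto simp: h_def)
  then have "bij_betw h (A \<union> - A) (B \<union> - B)" by (rule bij_betw_combine) auto
  then have "bij h" by simp
  moreover have "h k \<in> B \<longleftrightarrow> k \<in> A" for k
    using \<open>bij_betw h A B\<close> \<open>bij_betw h (- A) (- B)\<close> by (auto dest: bij_betwE)
  ultimately show thesis by (rule that)
qed

text \<open>The automorphisms of the tree of finite sequences, in which \<open>butlast l\<close> is
  the parent of \<open>l\<close>.\<close>

definition tree_auto :: "(nat list \<Rightarrow> nat list) \<Rightarrow> bool" where
  "tree_auto h \<longleftrightarrow> bij h \<and> (\<forall>l. length (h l) = length l) \<and> (\<forall>l. h (butlast l) = butlast (h l))"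

definition cons_map :: "(nat \<Rightarrow> nat) \<Rightarrow> (nat \<Rightarrow> nat list \<Rightarrow> nat list) \<Rightarrow> nat list \<Rightarrow> nat list" where
  "cons_map f h l = (case l of [] \<Rightarrow> [] | k # ks \<Rightarrow> f k # h k ks)"

lemma cons_map_simps [simp]: "cons_map f h [] = []" "cons_map f h (k # ks) = f k # h k ks"
  by (auto simp: cons_map_def)

lemma tree_auto_cons_map:
  assumes "bij f" "\<And>k. tree_auto (h k)"
  shows "tree_auto (cons_map f h)"
proof -
  have len: "length (h k l) = length l" and but: "h k (butlast l) = butlast (h k l)"
    and bij: "bij (h k)" for k l
    using assms(2) by (auto simp: tree_auto_def)
  have "inj (cons_map f h)"
  proof (rule injI)
    fix l l' assume "cons_map f h l = cons_map f h l'"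
    then show "l = l'"
      using assms(1) bij
      by (cases l; cases l') (auto simp: bij_def inj_eq)
  qed
  moreover have "l \<in> range (cons_map f h)" for l
  proof (cases l)
    case Nil
    then show ?thesis using cons_map_simps(1) by (metis rangeI)
  next
    case (Cons k ks)
    obtain k' where "f k' = k" using assms(1) by (metis bij_pointE)
    moreover obtain ks' where "h k' ks' = ks" using bij by (metis bij_pointE)
    ultimately show ?thesis using Cons cons_map_simps(2)[of f h k' ks'] by (metis rangeI)
  qed
  ultimately have "bij (cons_map f h)" by (auto simp: bij_def)
  moreover have "length (cons_map f h l) = length l" for l by (cases l) (auto simp: len)
  moreover have "cons_map f h (butlast l) = butlast (cons_map f h l)" for l
  proof (cases l)
    case (Cons k ks)
    then show ?thesis using len[of k ks] by (auto simp: but)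
  qed simp
  ultimately show ?thesis by (simp add: tree_auto_def)
qed

text \<open>Children are paired so that their values agree; the isomorphisms of their subtrees,
  given by induction, are glued by \<open>cons_map\<close>.\<close>

lemma saturated_iso:
  assumes "saturated m q" "saturated m q'" "val m q = val m q'"
  shows "\<exists>h. tree_auto h \<and> (\<forall>l. length l = m \<longrightarrow> q' (h l) = q l)"
  using assms
proof (induction m arbitrary: q q')
  case 0
  then show ?case by (intro exI[of _ id]) (use 0 in \<open>auto simp: tree_auto_def bij_def\<close>)
next
  case (Suc m)
  define A where "A = {k. val m (\<lambda>l. q (k # l))}"
  define B where "B = {k. val m (\<lambda>l. q' (k # l))}"
  \<comment> \<open>Equal values of the roots mean that both or neither have a false child, which is
    the last premise of the rule; \<open>f\<close> matches children of equal value.\<close>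
  obtain f where f: "bij f" and fAB: "\<And>k. f k \<in> B \<longleftrightarrow> k \<in> A"
  proof (rule bij_nat_preserving_set[of A B])
    have "- A = {k. \<not> val m (\<lambda>l. q (k # l))}" "- B = {k. \<not> val m (\<lambda>l. q' (k # l))}"
      by (auto simp: A_def B_def)
    then show "infinite A" "infinite B" "- A = {} \<or> infinite (- A)" "- B = {} \<or> infinite (- B)"
        "- A = {} \<longleftrightarrow> - B = {}"
      using Suc.prems by (auto simp: A_def B_def)
  qed blast
  have "\<exists>h. tree_auto h \<and> (\<forall>l. length l = m \<longrightarrow> q' (f k # h l) = q (k # l))" for k
    using fAB[of k] Suc.prems
    by (intro Suc.IH[of "\<lambda>l. q (k # l)" "\<lambda>l. q' (f k # l)"]) (auto simp: A_def B_def)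
  then obtain h where h: "\<And>k. tree_auto (h k)"
    and q: "\<And>k l. length l = m \<Longrightarrow> q' (f k # h k l) = q (k # l)"
    by metis
  have "q' (cons_map f h l) = q l" if "length l = Suc m" for l
    using that by (cases l) (auto simp: q)
  then show ?case using tree_auto_cons_map[OF f h] by (intro exI[of _ "cons_map f h"]) simp
qed

text \<open>Each inner node has a true child, so true nodes can be followed down to a leaf. This
  will make the height of a tree definable.\<close>

lemma saturated_ex_true:
  assumes "saturated m q" "val m q \<or> m > 0"
  shows "\<exists>l. length l = m \<and> q l"
  using assms
proof (induction m arbitrary: q)
  case (Suc m)
  then have "{k. val m (\<lambda>l. q (k # l))} \<noteq> {}" by (metis finite.emptyI saturated.simps(2))
  then obtain k where "val m (\<lambda>l. q (k # l))" by auto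
  then obtain l where "length l = m" "q (k # l)"
    using Suc.IH[of "\<lambda>l. q (k # l)"] Suc.prems by auto
  then show ?case by (intro exI[of _ "k # l"]) simp
qed simp

section \<open>Canonical trees of either value, and padding\<close>

primrec canonical :: "bool \<Rightarrow> nat list \<Rightarrow> bool" where
  "canonical b [] = b"
| "canonical b (k # l) = canonical (b \<longrightarrow> even k) l"

text \<open>The label handed down is the value: a false node gets only true children, a true node
  gets false ones at the odd positions, of which \<open>1\<close> is the witness.\<close>

lemma val_canonical: "val m (canonical b) = b"
  by (induction m arbitrary: b) (auto intro: exI[of _ 1])

lemma infinite_even: "infinite {k::nat. even k}"
  unfolding infinite_nat_iff_unbounded_le
proof
  show "\<exists>n\<ge>m. n \<in> {k. even k}" for m :: nat by (rule exI[of _ "2 * m"]) simp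
qed

lemma infinite_odd: "infinite {k::nat. odd k}"
  unfolding infinite_nat_iff_unbounded_le
proof
  show "\<exists>n\<ge>m. n \<in> {k. odd k}" for m :: nat by (rule exI[of _ "Suc (2 * m)"]) simp
qed

lemma saturated_canonical: "saturated m (canonical b)"
proof (induction m arbitrary: b)
  case (Suc m)
  then show ?case
    using infinite_even infinite_odd infinite_UNIV_nat by (cases b) (simp_all add: val_canonical)
qed simp

text \<open>Even children are canonical true trees; the odd ones repeat every child of \<open>q\<close> infinitely often.\<close>

primrec pad :: "nat list \<Rightarrow> (nat list \<Rightarrow> bool) \<Rightarrow> bool" where
  "pad [] q = q []"
| "pad (k # l) q = (if even k then canonical True l
     else pad l (\<lambda>l. q (fst (prod_decode (k div 2)) # l)))"

text \<open>Adding true children and repeating given ones does not affect the existence of a false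
  child, so the value is kept.\<close>

lemma val_saturated_pad: "val m (\<lambda>l. pad l q) = val m q \<and> saturated m (\<lambda>l. pad l q)"
proof (induction m arbitrary: q)
  case (Suc m)
  define c where "c k = fst (prod_decode (k div 2))" for k
  have val: "val m (\<lambda>l. pad (k # l) q) = (even k \<or> val m (\<lambda>l. q (c k # l)))" for k
    using Suc.IH[of "\<lambda>l. q (c k # l)"] by (cases "even k") (simp_all add: c_def val_canonical)
  have sat: "saturated m (\<lambda>l. pad (k # l) q)" for k
    using Suc.IH[of "\<lambda>l. q (c k # l)"] by (cases "even k") (simp_all add: c_def saturated_canonical)
  \<comment> \<open>The positions \<open>w i j\<close>, for all \<open>j\<close>, are odd and repeat
    child \<open>i\<close> of \<open>q\<close>.\<close>
  define w where "w i j = Suc (2 * prod_encode (i, j))" for i j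
  have w: "odd (w i j)" "c (w i j) = i" for i j
    by (simp_all add: w_def c_def)
  have inf: "infinite {k. odd k \<and> c k = i}" for i
  proof (rule infinite_super)
    show "range (w i) \<subseteq> {k. odd k \<and> c k = i}" using w by auto
    show "infinite (range (w i))"
      by (intro range_inj_infinite injI) (simp add: w_def)
  qed
  have "val (Suc m) (\<lambda>l. pad l q) = val (Suc m) q"
    unfolding val.simps val using w by metis
  moreover have "infinite {k. val m (\<lambda>l. pad (k # l) q)}"
    using infinite_even by (rule infinite_super[rotated]) (auto simp: val val_canonical[of m True])
  moreover have "infinite {k. \<not> val m (\<lambda>l. pad (k # l) q)}"
    if ne: "{k. \<not> val m (\<lambda>l. pad (k # l) q)} \<noteq> {}"
  proof -
    obtain k where "\<not> val m (\<lambda>l. q (c k # l))" using ne unfolding val by auto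
    then have "{k'. odd k' \<and> c k' = c k} \<subseteq> {k. \<not> val m (\<lambda>l. pad (k # l) q)}"
      unfolding val by auto
    then show ?thesis using inf infinite_super by blast
  qed
  ultimately show ?case using sat by (simp only: saturated.simps) blast
qed simp

section \<open>Finitary predicates and a fixed point\<close>

text \<open>By compactness these are the clopen predicates on the product; a finite support makes
  them easy to combine.\<close>

definition finitary :: "(('a \<Rightarrow> bool) \<Rightarrow> bool) \<Rightarrow> bool" where
  "finitary F \<longleftrightarrow> (\<exists>A. finite A \<and> (\<forall>x y. (\<forall>a\<in>A. x a = y a) \<longrightarrow> F x = F y))"

lemma finitaryI:
  "finite A \<Longrightarrow> (\<And>x y. (\<And>a. a \<in> A \<Longrightarrow> x a = y a) \<Longrightarrow> F x = F y) \<Longrightarrow> finitary F"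
  unfolding finitary_def by blast

lemma finitary_const [intro]: "finitary (\<lambda>x. b)"
  by (rule finitaryI[of "{}"]) auto

lemma finitary_apply [intro]: "finitary (\<lambda>x. x a)"
  by (rule finitaryI[of "{a}"]) auto

lemma finitary_op:
  assumes "finitary F" "finitary G"
  shows "finitary (\<lambda>x. f (F x) (G x))"
proof -
  obtain A B where A: "finite A" "\<And>x y. (\<forall>a\<in>A. x a = y a) \<Longrightarrow> F x = F y"
    and B: "finite B" "\<And>x y. (\<forall>a\<in>B. x a = y a) \<Longrightarrow> G x = G y"
    using assms unfolding finitary_def by metis
  show ?thesis
  proof (rule finitaryI[of "A \<union> B"])
    fix x y :: "'a \<Rightarrow> bool" assume "\<And>a. a \<in> A \<union> B \<Longrightarrow> x a = y a"
    then have "F x = F y" "G x = G y" using A(2)[of x y] B(2)[of x y] by auto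
    then show "f (F x) (G x) = f (F y) (G y)" by simp
  qed (use A B in auto)
qed

lemmas finitary_conj = finitary_op[of _ _ "(\<and>)"]
lemmas finitary_disj = finitary_op[of _ _ "(\<or>)"]

lemma finitary_not: "finitary F \<Longrightarrow> finitary (\<lambda>x. \<not> F x)"
  using finitary_op[of F F "\<lambda>a b. \<not> a"] by simp

text \<open>\<open>pad l q\<close> looks up at most one value of \<open>q\<close>.\<close>

lemma finitary_pad:
  assumes "\<And>l. finitary (\<lambda>x. q x l)"
  shows "finitary (\<lambda>x. pad l (q x))"
  using assms
proof (induction l arbitrary: q)
  case (Cons k l)
  show ?case
  proof (cases "even k")
    case False
    then show ?thesis
      using Cons.IH[of "\<lambda>x l. q x (fst (prod_decode (k div 2)) # l)"] Cons.prems by simp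
  qed auto
qed simp

lemma continuous_on_finitary:
  fixes F :: "(nat \<Rightarrow> bool) \<Rightarrow> bool"
  assumes "finitary F"
  shows "continuous_on UNIV F"
proof -
  obtain A where A: "finite A" "\<And>x y. (\<forall>a\<in>A. x a = y a) \<Longrightarrow> F x = F y"
    using assms unfolding finitary_def by metis
  have cyl: "open {y. \<forall>a\<in>A. y a = x a}" for x :: "nat \<Rightarrow> bool"
  proof -
    have "{y. \<forall>a\<in>A. y a = x a} = Pi\<^sub>E UNIV (\<lambda>a. if a \<in> A then {x a} else UNIV)"
      by (auto simp: PiE_def Pi_def split: if_splits)
    also have "open \<dots>"
      by (rule open_PiE) (auto simp: open_discrete intro: finite_subset[OF _ A(1)])
    finally show ?thesis .
  qed
  have "F -` B = (\<Union>x\<in>F -` B. {y. \<forall>a\<in>A. y a = x a})" for B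
    using A(2) by blast
  then have "open (F -` B)" for B
    using cyl by (metis (no_types, lifting) open_UN)
  then show ?thesis by (simp add: continuous_on_open_vimage)
qed

text \<open>The last quantifier only asks whether some \<open>k\<close> fails, not which one; this
  leaves room for delaying failures.\<close>

lemma val_inner_cong:
  assumes "\<And>l. length l = m \<Longrightarrow> (\<exists>k. \<not> q (l @ [k])) = (\<exists>k. \<not> q' (l @ [k]))"
  shows "val (Suc m) q = val (Suc m) q'"
  using assms
proof (induction m arbitrary: q q')
  case 0
  then show ?case by simp
next
  case (Suc m)
  have "val (Suc m) (\<lambda>l. q (k # l)) = val (Suc m) (\<lambda>l. q' (k # l))" for k
    using Suc.prems[of "k # l" for l] by (intro Suc.IH) simp
  then show ?case by (simp only: val.simps(2)[of "Suc m"])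
qed

text \<open>
  A continuous operator \<open>T\<close> need not have a fixed point, but it can be delayed along the last
  quantifier until its value only depends on earlier arguments; the delayed operator has a fixed
  point and the same value.
\<close>

lemma val_fixed_point:
  fixes T :: "(nat list \<Rightarrow> bool) \<Rightarrow> nat list \<Rightarrow> bool"
  assumes "\<And>l. finitary (\<lambda>q. T q l)"
  shows "\<exists>q. val (Suc m) q = val (Suc m) (T q)"
proof -
  obtain A where fin: "\<And>l. finite (A l)"
    and A: "\<And>l q q'. (\<And>a. a \<in> A l \<Longrightarrow> q a = q' a) \<Longrightarrow> T q l = T q' l"
    using assms unfolding finitary_def by metis
  \<comment> \<open>For \<open>l = l' @ [k]\<close>, the positions \<open>j \<le> k\<close> are
    tested if the support of \<open>T\<close> there has only last entries below \<open>k\<close>;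
    positions not yet decidable count as true.\<close>
  define D where "D q l \<longleftrightarrow> (\<forall>j\<le>last l. (\<forall>a\<in>A (butlast l @ [j]). last a < last l)
      \<longrightarrow> T q (butlast l @ [j]))" for q l
  have "D q l = D q' l" if "\<And>a. (a, l) \<in> inv_image less_than last \<Longrightarrow> q a = q' a" for q q' l
  proof -
    have "T q (butlast l @ [j]) = T q' (butlast l @ [j])"
      if "\<forall>a\<in>A (butlast l @ [j]). last a < last l" for j
      using that \<open>\<And>a. (a, l) \<in> inv_image less_than last \<Longrightarrow> q a = q' a\<close> by (intro A) auto
    then show ?thesis unfolding D_def by blast
  qed
  \<comment> \<open>\<open>D q l\<close> uses \<open>q\<close> only at lists with a smaller last
    entry, so recursion on the last entry yields a fixed point.\<close>
  then have "adm_wf (inv_image less_than last) D" unfolding adm_wf_def by blast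
  then have fix_D: "wfrec (inv_image less_than last) D = D (wfrec (inv_image less_than last) D)"
    by (rule wfrec_fixpoint[OF wf_inv_image[OF wf_less_than]])
  define q where "q = wfrec (inv_image less_than last) D"
  have "(\<exists>k. \<not> q (l @ [k])) = (\<exists>k. \<not> T q (l @ [k]))" for l
  proof
    assume "\<exists>k. \<not> q (l @ [k])"
    then obtain k where "\<not> D q (l @ [k])" using fix_D q_def by metis
    then show "\<exists>k. \<not> T q (l @ [k])" by (auto simp: D_def)
  next
    assume "\<exists>k. \<not> T q (l @ [k])"
    then obtain j where j: "\<not> T q (l @ [j])" by blast
    \<comment> \<open>Exceeds \<open>j\<close> and all last entries in the support at
      \<open>j\<close>, so that the failure at \<open>j\<close> is noticed at stage
      \<open>k\<close>.\<close>
    define k where "k = j + Suc (sum last (A (l @ [j])))"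
    have "last a < k" if "a \<in> A (l @ [j])" for a
      using member_le_sum[OF that, of last] fin by (simp add: k_def)
    moreover have "j \<le> k" by (simp add: k_def)
    ultimately have "\<not> D q (l @ [k])" using j by (auto simp: D_def)
    then show "\<exists>k. \<not> q (l @ [k])" using fix_D q_def by metis
  qed
  then show ?thesis using val_inner_cong[of m q "T q"] by blast
qed

text \<open>The boldface classes \<open>\<Sigma>\<^sub>m\<close> of predicates of \<open>q\<close>, starting from the clopen ones.\<close>

fun Sig :: "nat \<Rightarrow> (('a \<Rightarrow> bool) \<Rightarrow> bool) set" where
  "Sig 0 = Collect finitary"
| "Sig (Suc m) = {F. \<exists>G. (\<forall>k::nat. G k \<in> Sig m) \<and> F = (\<lambda>q. \<exists>k. \<not> G k q)}"

lemma SigI: "(\<And>k::nat. G k \<in> Sig m) \<Longrightarrow> (\<lambda>q. \<exists>k. \<not> G k q) \<in> Sig (Suc m)"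
  unfolding Sig.simps mem_Collect_eq by (rule exI[of _ G]) simp

lemma Sig_const: "(\<lambda>q. b) \<in> Sig m"
proof (induction m arbitrary: b)
  case (Suc m)
  show ?case using SigI[of "\<lambda>_ _. \<not> b", OF Suc] by simp
qed auto

lemma Sig_not: "F \<in> Sig m \<Longrightarrow> (\<lambda>q. \<not> F q) \<in> Sig (Suc m)"
  using SigI[of "\<lambda>_. F" m] by simp

text \<open>Each \<open>F k\<close> is negated to fit \<open>SigI\<close>, which costs one level,
  and the union costs another; hence the difference of two between \<open>n\<close> and the height
  of the tree used against axiomatizability.\<close>

lemma Sig_union: "(\<And>k. F k \<in> Sig m) \<Longrightarrow> (\<lambda>q. \<exists>k::nat. F k q) \<in> Sig (Suc (Suc m))"
  using SigI[of "\<lambda>k q. \<not> F k q" "Suc m"] Sig_not by force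

text \<open>A normal form: the matrices of the countably many predicates one level down become the
  subtrees at the children \<open>k\<close> of a single matrix.\<close>

lemma Sig_val:
  assumes "F \<in> Sig m"
  shows "\<exists>T. (\<forall>l. finitary (\<lambda>q. T q l)) \<and> (\<forall>q. F q = val m (T q))"
  using assms
proof (induction m arbitrary: F)
  case 0
  then show ?case by (intro exI[of _ "\<lambda>q l. F q"]) simp
next
  case (Suc m)
  from Suc.prems obtain G where G: "\<forall>k::nat. G k \<in> Sig m" "F = (\<lambda>q. \<exists>k. \<not> G k q)"
    unfolding Sig.simps mem_Collect_eq by (elim exE conjE) (rule that)
  have "\<forall>k. \<exists>T::('a \<Rightarrow> bool) \<Rightarrow> nat list \<Rightarrow> bool. (\<forall>l. finitary (\<lambda>q. T q l)) \<and> (\<forall>q. G k q = val m (T q))"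
    using Suc.IH[OF spec[OF G(1)]] by blast
  from choice[OF this] obtain T where
    T: "\<And>k l. finitary (\<lambda>q. T k q l)" "\<And>k q. G k q = val m (T k q)"
    by blast
  \<comment> \<open>The value at \<open>[]\<close> is arbitrary, as \<open>val (Suc m)\<close> never
    reads it.\<close>
  define T' where "T' q l = (case l of [] \<Rightarrow> True | k # l \<Rightarrow> T k q l)" for q l
  have "finitary (\<lambda>q. T' q l)" for l
    by (cases l) (auto simp: T'_def T(1))
  moreover have "F q = val (Suc m) (T' q)" for q
    by (simp add: G(2) T(2) T'_def)
  ultimately show ?case by blast
qed

text \<open>The hierarchy is proper: by the normal form, membership would yield a continuous
  operator negating the value of every matrix, against the fixed point.\<close>

lemma not_Sig_not_val: "(\<lambda>q. \<not> val (Suc m) q) \<notin> Sig (Suc m)"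
proof
  assume "(\<lambda>q. \<not> val (Suc m) q) \<in> Sig (Suc m)"
  from Sig_val[OF this] obtain T :: "(nat list \<Rightarrow> bool) \<Rightarrow> nat list \<Rightarrow> bool"
    where "\<And>l. finitary (\<lambda>q. T q l)" "\<And>q. (\<not> val (Suc m) q) = val (Suc m) (T q)"
    by auto
  then show False using val_fixed_point[of T m] by metis
qed

section \<open>The forest structures\<close>

text \<open>
  The subtree at \<open>[n]\<close> codes \<open>val n (Q n)\<close>: a quantifier-free truth value is stored as the existence
  of children of a node \<open>n # ks\<close> with \<open>length ks = n\<close>.
\<close>

definition present :: "(nat \<Rightarrow> nat list \<Rightarrow> bool) \<Rightarrow> nat list \<Rightarrow> bool" where
  "present Q l = (case l of [] \<Rightarrow> True
     | n # ks \<Rightarrow> length ks \<le> n \<or> length ks = Suc n \<and> Q n (butlast ks))"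

lemma present_simps [simp]:
  "present Q []"
  "present Q (n # ks) \<longleftrightarrow> length ks \<le> n \<or> length ks = Suc n \<and> Q n (butlast ks)"
  by (simp_all add: present_def)

lemma present_snoc: "present Q (l @ [k]) \<Longrightarrow> present Q l"
  by (cases l) auto

lemma snoc_iff: "(\<exists>k. l' = l @ [k]) \<longleftrightarrow> l' \<noteq> [] \<and> butlast l' = l"
  by (metis append_butlast_last_id butlast_snoc snoc_eq_iff_butlast)

locale finite_models =
  fixes M :: "nat \<Rightarrow> ('k, 'u) struct"
    and C :: "nat \<Rightarrow> nat \<Rightarrow> 'k set"
    and e :: "nat \<Rightarrow> nat \<Rightarrow> 'k \<Rightarrow> 'u"
  assumes finite_T0_model: "finite_T0_model (M i)"
    and disjoint: "(i, j) \<noteq> (i', j') \<Longrightarrow> C i j \<inter> C i' j' = {}"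
    and bij: "bij_betw (e i j) (C i j) (univ (M i))"
    and countable: "countable (all_csts C)"
begin

text \<open>Absent sequences remain as elements without any relation, so that the universe does not
  depend on \<open>Q\<close>. Constants outside \<open>all_csts C\<close>, among them later
  \<open>a\<close>, name the root.\<close>

definition forest :: "(nat \<Rightarrow> nat list \<Rightarrow> bool) \<Rightarrow> ('k, 'k + nat list) struct" where
  "forest Q = \<lparr>univ = all_csts C <+> UNIV,
     rP = \<lambda>i u. case u of
         Inl c \<Rightarrow> \<exists>i' j. c \<in> C i' j \<and> rP (M i') i (e i' j c)
       | Inr l \<Rightarrow> length l = i \<and> present Q l,
     rL = \<lambda>i u w. case u of
         Inl c \<Rightarrow> (case w of
             Inl d \<Rightarrow> \<exists>i' j. c \<in> C i' j \<and> d \<in> C i' j \<and> rL (M i') i (e i' j c) (e i' j d)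
           | Inr l \<Rightarrow> False)
       | Inr l \<Rightarrow> (case w of
             Inl d \<Rightarrow> False
           | Inr l' \<Rightarrow> length l = i \<and> l' \<noteq> [] \<and> butlast l' = l \<and> present Q l'),
     cst = \<lambda>c. if c \<in> all_csts C then Inl c else Inr []\<rparr>"

lemma forest_simps [simp]:
  "univ (forest Q) = all_csts C <+> UNIV"
  "rP (forest Q) i (Inl c) \<longleftrightarrow> (\<exists>i' j. c \<in> C i' j \<and> rP (M i') i (e i' j c))"
  "rP (forest Q) i (Inr l) \<longleftrightarrow> length l = i \<and> present Q l"
  "rL (forest Q) i (Inl c) (Inl d)
     \<longleftrightarrow> (\<exists>i' j. c \<in> C i' j \<and> d \<in> C i' j \<and> rL (M i') i (e i' j c) (e i' j d))"
  "\<not> rL (forest Q) i (Inl c) (Inr l)"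
  "\<not> rL (forest Q) i (Inr l) (Inl c)"
  "rL (forest Q) i (Inr l) (Inr l') \<longleftrightarrow> length l = i \<and> l' \<noteq> [] \<and> butlast l' = l \<and> present Q l'"
  "cst (forest Q) c = (if c \<in> all_csts C then Inl c else Inr [])"
  by (simp_all add: forest_def)

lemma block_unique: "c \<in> C i j \<Longrightarrow> c \<in> C i' j' \<Longrightarrow> i' = i \<and> j' = j"
  using disjoint[of i j i' j'] by blast

lemma ex_block:
  assumes "c \<in> C i j"
  shows "(\<exists>i' j'. c \<in> C i' j' \<and> X i' j') \<longleftrightarrow> X i j"
proof
  assume "\<exists>i' j'. c \<in> C i' j' \<and> X i' j'"
  then obtain i' j' where "c \<in> C i' j'" "X i' j'" by blast
  then show "X i j" using block_unique[OF assms] by blast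
qed (use assms in blast)

lemma forest_block:
  assumes "c \<in> C i j"
  shows "c \<in> all_csts C"
    and "rP (forest Q) k (Inl c) \<longleftrightarrow> rP (M i) k (e i j c)"
    and "rL (forest Q) k (Inl c) (Inl d) \<longleftrightarrow> d \<in> C i j \<and> rL (M i) k (e i j c) (e i j d)"
    and "rL (forest Q) k (Inl d) (Inl c) \<longleftrightarrow> d \<in> C i j \<and> rL (M i) k (e i j d) (e i j c)"
proof -
  show "c \<in> all_csts C" using assms by (auto simp: all_csts_def)
  show "rP (forest Q) k (Inl c) \<longleftrightarrow> rP (M i) k (e i j c)"
    unfolding forest_simps by (rule ex_block[OF assms])
  show "rL (forest Q) k (Inl c) (Inl d) \<longleftrightarrow> d \<in> C i j \<and> rL (M i) k (e i j c) (e i j d)"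
    unfolding forest_simps by (rule ex_block[OF assms])
  show "rL (forest Q) k (Inl d) (Inl c) \<longleftrightarrow> d \<in> C i j \<and> rL (M i) k (e i j d) (e i j c)"
    unfolding forest_simps
    using ex_block[OF assms, of "\<lambda>i' j'. d \<in> C i' j' \<and> rL (M i') k (e i' j' d) (e i' j' c)"]
    by (simp only: conj_left_commute)
qed

section \<open>The forests as models of \<open>T\<close>\<close>

lemma M_T0:
  shows "univ (M i) \<noteq> {}"
    and "x \<in> univ (M i) \<Longrightarrow> rP (M i) k x \<Longrightarrow> rP (M i) k' x \<Longrightarrow> k = k'"
    and "x \<in> univ (M i) \<Longrightarrow> y \<in> univ (M i) \<Longrightarrow> rL (M i) k x y \<Longrightarrow> rP (M i) k x \<and> rP (M i) (Suc k) y"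
    and "x \<in> univ (M i) \<Longrightarrow> rP (M i) (Suc k) x \<Longrightarrow> \<exists>y\<in>univ (M i). rP (M i) k y \<and> rL (M i) k y x"
    and "x \<in> univ (M i) \<Longrightarrow> y \<in> univ (M i) \<Longrightarrow> z \<in> univ (M i)
      \<Longrightarrow> rL (M i) k x z \<Longrightarrow> rL (M i) k y z \<Longrightarrow> x = y"
proof -
  have ne: "univ (M i) \<noteq> {}" and T0: "models (M i) T0"
    using finite_T0_model[of i] by (auto simp: finite_T0_model_def is_struct_def)
  show "univ (M i) \<noteq> {}" by (fact ne)
  note T0 = T0[unfolded models_T0_iff, simplified ne simp_thms]
  show "k = k'" if "x \<in> univ (M i)" "rP (M i) k x" "rP (M i) k' x"
    using T0 that by blast
  show "rP (M i) k x \<and> rP (M i) (Suc k) y" if "x \<in> univ (M i)" "y \<in> univ (M i)" "rL (M i) k x y"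
    using T0 that by blast
  show "\<exists>y\<in>univ (M i). rP (M i) k y \<and> rL (M i) k y x" if "x \<in> univ (M i)" "rP (M i) (Suc k) x"
    using T0 that by blast
  show "x = y" if "x \<in> univ (M i)" "y \<in> univ (M i)" "z \<in> univ (M i)"
      "rL (M i) k x z" "rL (M i) k y z"
    using T0 that by blast
qed

lemma e_in: "c \<in> C i j \<Longrightarrow> e i j c \<in> univ (M i)"
  using bij[of i j] by (auto simp: bij_betw_def)

lemma e_inj: "c \<in> C i j \<Longrightarrow> d \<in> C i j \<Longrightarrow> e i j c = e i j d \<longleftrightarrow> c = d"
  using bij[of i j] by (auto simp: bij_betw_def inj_on_def)

lemma all_cstsE:
  assumes "c \<in> all_csts C"
  obtains i j where "c \<in> C i j"
  using assms by (auto simp: all_csts_def)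

lemma forest_T0: "models (forest Q) T0"
  unfolding models_T0_iff
proof (intro disjI2 conjI allI impI ballI)
  fix i j :: nat and u
  assume "i \<noteq> j" "u \<in> univ (forest Q)"
  then show "\<not> (rP (forest Q) i u \<and> rP (forest Q) j u)"
  proof (cases u)
    case (Inl c)
    then obtain i' j' where "c \<in> C i' j'" using \<open>u \<in> _\<close> by (auto elim: all_cstsE)
    then show ?thesis
      using Inl \<open>i \<noteq> j\<close> M_T0(2)[OF e_in] by (auto simp: forest_block simp del: forest_simps)
  qed auto
next
  fix i :: nat and u w
  assume u: "u \<in> univ (forest Q)" and w: "w \<in> univ (forest Q)" and L: "rL (forest Q) i u w"
  have "rP (forest Q) i u \<and> rP (forest Q) (Suc i) w"
  proof (cases u)
    case (Inl c)
    then obtain d where d: "w = Inl d" using L by (cases w) auto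
    then obtain i' j' where ij: "c \<in> C i' j'" "d \<in> C i' j'" "rL (M i') i (e i' j' c) (e i' j' d)"
      using Inl L by auto
    then have "rP (M i') i (e i' j' c) \<and> rP (M i') (Suc i) (e i' j' d)"
      by (intro M_T0(3) e_in)
    then show ?thesis using Inl d ij(1,2) by (simp add: forest_block del: forest_simps)
  next
    case (Inr l)
    then obtain l' where l': "w = Inr l'" using L by (cases w) auto
    then have *: "length l = i" "l' = l @ [last l']" "present Q l'"
      using Inr L by (auto simp: append_butlast_last_id)
    then have "present Q l" using present_snoc[of Q l "last l'"] by simp
    moreover have "length l' = Suc i" using *(1) arg_cong[OF *(2), of length] by simp
    ultimately show ?thesis using Inr l' * by simp
  qed
  then show "rP (forest Q) i u" "rP (forest Q) (Suc i) w" by auto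
next
  fix i :: nat and u
  assume u: "u \<in> univ (forest Q)" and P: "rP (forest Q) (Suc i) u"
  show "\<exists>w\<in>univ (forest Q). rP (forest Q) i w \<and> rL (forest Q) i w u"
  proof (cases u)
    case (Inl c)
    then obtain i' j' where ij: "c \<in> C i' j'" "rP (M i') (Suc i) (e i' j' c)" using P by auto
    then obtain y where y: "y \<in> univ (M i')" "rP (M i') i y" "rL (M i') i y (e i' j' c)"
      using M_T0(4) e_in by blast
    then obtain d where d: "d \<in> C i' j'" "y = e i' j' d"
      using bij[of i' j'] by (auto simp: bij_betw_def)
    show ?thesis
      using y d ij Inl by (intro bexI[of _ "Inl d"]) (auto simp: all_csts_def)
  next
    case (Inr l)
    then have l: "l = butlast l @ [last l]" "present Q l" "length l = Suc i" "l \<noteq> []"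
      using P by (cases l rule: rev_cases; auto)+
    then have "present Q (butlast l)" using present_snoc[of Q "butlast l" "last l"] by simp
    then show ?thesis using l Inr by (intro bexI[of _ "Inr (butlast l)"]) auto
  qed
next
  fix i :: nat and u w x
  assume "u \<in> univ (forest Q)" "w \<in> univ (forest Q)" "x \<in> univ (forest Q)"
    and L: "rL (forest Q) i u x \<and> rL (forest Q) i w x"
  show "u = w"
  proof (cases x)
    case (Inl c)
    then obtain d d' where d: "u = Inl d" "w = Inl d'" using L by (cases u; cases w) auto
    then obtain i' j' where ij: "c \<in> C i' j'" using L Inl by auto
    then have "d \<in> C i' j'" "rL (M i') i (e i' j' d) (e i' j' c)"
      "d' \<in> C i' j'" "rL (M i') i (e i' j' d') (e i' j' c)"
      using L Inl d by (simp_all add: forest_block del: forest_simps)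
    then have "e i' j' d = e i' j' d'" using M_T0(5)[OF e_in e_in e_in] ij by blast
    then show ?thesis using d \<open>d \<in> C i' j'\<close> \<open>d' \<in> C i' j'\<close> by (simp add: e_inj)
  next
    case (Inr l)
    then show ?thesis using L by (cases u; cases w) auto
  qed
qed

lemma sat_one_of: "sat N v (one_of cs t) \<longleftrightarrow> (\<exists>c\<in>set cs. tval N v t = cst N c)"
  by (induction cs) (auto simp: one_of_def)

text \<open>Each block \<open>C i j\<close> copies \<open>M i\<close> along \<open>e i j\<close>,
  and no relation leaves a block, whatever the tree beside it is.\<close>

lemma forest_theory_T:
  assumes "\<phi> \<in> theory_T M C e"
  shows "holds (forest Q) \<phi>"
proof -
  consider "\<phi> \<in> T0"
    | c d where "\<phi> = Neg (Eq (Cst c) (Cst d))" "c \<in> all_csts C" "d \<in> all_csts C" "c \<noteq> d"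
    | i j where "\<phi> \<in> literals_true_in (C i j) ((M i)\<lparr>cst := e i j\<rparr>)"
    | i j k cs where "\<phi> = All 0 (All 1 (Imp
          (Conj (one_of cs (Var 0)) (Disj (Lt k (Var 0) (Var 1)) (Lt k (Var 1) (Var 0))))
          (one_of cs (Var 1))))" "set cs = C i j"
    using assms unfolding theory_T_def
    by (elim UnE UN_E CollectE exE conjE) (rule that; assumption)+
  then show ?thesis
  proof cases
    case 1
    then show ?thesis using forest_T0 by (auto simp: models_def)
  next
    case 2
    then show ?thesis by (auto simp: holds_def)
  next
    case (3 i j)
    let ?N = "(M i)\<lparr>cst := e i j\<rparr>"
    obtain y where y: "y \<in> univ (M i)" using M_T0(1)[of i] by auto
    have eq: "holds (forest Q) \<psi> \<longleftrightarrow> holds ?N \<psi>" "holds (forest Q) (Neg \<psi>) \<longleftrightarrow> \<not> holds (forest Q) \<psi>"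
      if at: "\<psi> \<in> atomic_sentences (C i j)" for \<psi>
    proof -
      have fv: "fv \<psi> = {}" and cs: "csts \<psi> \<subseteq> C i j" and "atomic \<psi>"
        using at by (auto simp: atomic_sentences_def sentences_def)
      have h: "holds (forest Q) \<psi> \<longleftrightarrow> sat (forest Q) (\<lambda>_. Inr []) \<psi>"
          "holds (forest Q) (Neg \<psi>) \<longleftrightarrow> \<not> sat (forest Q) (\<lambda>_. Inr []) \<psi>"
          "holds ?N \<psi> \<longleftrightarrow> sat ?N (\<lambda>_. y) \<psi>"
        using fv y by (subst holds_sentence; auto)+
      have tm: "\<exists>c. t = Cst c \<and> c \<in> C i j" if "tm_vars t = {}" "set_tm t \<subseteq> C i j" for t
        using that by (cases t) auto
      have "sat (forest Q) (\<lambda>_. Inr []) \<psi> \<longleftrightarrow> sat ?N (\<lambda>_. y) \<psi>"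
      proof (cases \<psi>)
        case (Eq s t)
        then obtain c d where "s = Cst c" "c \<in> C i j" "t = Cst d" "d \<in> C i j"
          using fv cs tm[of s] tm[of t] by auto
        then show ?thesis using Eq by (auto simp: e_inj forest_block(1))
      next
        case (Pr k t)
        then obtain c where "t = Cst c" "c \<in> C i j" using fv cs tm[of t] by auto
        then show ?thesis
          using Pr forest_block(1,2)[of c i j] by (simp del: forest_simps(2))
      next
        case (Lt k s t)
        then obtain c d where "s = Cst c" "c \<in> C i j" "t = Cst d" "d \<in> C i j"
          using fv cs tm[of s] tm[of t] by auto
        then show ?thesis
          using Lt forest_block(1,3)[of c i j] forest_block(1)[of d i j] by (simp del: forest_simps(4))
      qed (use \<open>atomic \<psi>\<close> in auto)
      with h show "holds (forest Q) \<psi> \<longleftrightarrow> holds ?N \<psi>"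
        "holds (forest Q) (Neg \<psi>) \<longleftrightarrow> \<not> holds (forest Q) \<psi>" by auto
    qed
    from 3 show ?thesis unfolding literals_true_in_def using eq by blast
  next
    case (4 i j k cs)
    have "sat (forest Q) (v(0 := u, 1 := w)) (one_of cs (Var 1))"
      if one: "sat (forest Q) (v(0 := u, 1 := w)) (one_of cs (Var 0))"
        and rel: "rL (forest Q) k u w \<or> rL (forest Q) k w u" for v u w
    proof -
      obtain c where c: "c \<in> C i j" "u = Inl c"
        using one 4(2) forest_block(1) by (auto simp: sat_one_of)
      then obtain d where d: "w = Inl d" using rel by (cases w) auto
      then have "d \<in> C i j"
        using rel c forest_block(3,4)[OF c(1)] by (auto simp del: forest_simps)
      then show ?thesis using d 4(2) forest_block(1) by (auto simp: sat_one_of)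
    qed
    then show ?thesis using 4(1) by (auto simp: holds_def)
  qed
qed

section \<open>Dependence of the root on the values of the trees\<close>

lemma forest_iso:
  assumes h: "\<And>n. tree_auto (h n)" and Q: "\<And>n l. length l = n \<Longrightarrow> Q' n (h n l) = Q n l"
  shows "sat (forest Q') (\<lambda>_. Inr []) \<phi> = sat (forest Q) (\<lambda>_. Inr []) \<phi>"
proof -
  \<comment> \<open>\<open>H\<close> fixes the children of the root and acts by \<open>h n\<close>
    on the \<open>n\<close>-th tree. Agreement of the matrices at length \<open>n\<close> suffices,
    since shorter sequences are always present.\<close>
  define H where "H = cons_map (\<lambda>n. n) h"
  have "tree_auto H" unfolding H_def by (rule tree_auto_cons_map[OF _ h]) (simp add: bij_def)
  then have bij: "bij H" and len: "\<And>l. length (H l) = length l"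
    and but: "\<And>l. butlast (H l) = H (butlast l)"
    by (auto simp: tree_auto_def)
  have present: "present Q' (H l) = present Q l" for l
  proof (cases l)
    case Nil
    then show ?thesis by (simp add: H_def)
  next
    case (Cons n ks)
    have "length (h n ks) = length ks" "butlast (h n ks) = h n (butlast ks)"
      using h[of n] by (auto simp: tree_auto_def)
    then show ?thesis using Cons Q[of "butlast ks" n] by (auto simp: H_def)
  qed
  have nil: "H l = [] \<longleftrightarrow> l = []" for l using len[of l] by (metis length_0_conv)
  have eq: "H l = H l' \<longleftrightarrow> l = l'" for l l' using bij by (simp add: bij_def inj_eq)
  have H_nil: "H [] = []" by (simp add: H_def)
  have "sat (forest Q') (\<lambda>x. map_sum id H ((\<lambda>_. Inr []) x)) \<phi> = sat (forest Q) (\<lambda>_. Inr []) \<phi>"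
  proof (rule sat_iso)
    show "bij_betw (map_sum id H) (univ (forest Q)) (univ (forest Q'))"
    proof (rule bij_betwI')
      show "(map_sum id H x = map_sum id H y) = (x = y)" for x y :: "'k + nat list"
        by (cases x; cases y) (auto simp: eq)
      show "map_sum id H x \<in> univ (forest Q')" if "x \<in> univ (forest Q)" for x
        using that by auto
      show "\<exists>x\<in>univ (forest Q). y = map_sum id H x" if "y \<in> univ (forest Q')" for y
      proof (cases y)
        case (Inl c)
        then show ?thesis using that by (intro bexI[of _ "Inl c"]) auto
      next
        case (Inr l)
        obtain l' where "H l' = l" using bij by (metis bij_pointE)
        then show ?thesis using Inr by (intro bexI[of _ "Inr l'"]) auto
      qed
    qed
    show "rP (forest Q') i (map_sum id H x) = rP (forest Q) i x" for i x
      by (cases x) (auto simp: len present)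
    show "rL (forest Q') i (map_sum id H x) (map_sum id H y) = rL (forest Q) i x y" for i x y
      by (cases x; cases y) (auto simp: len present but eq nil)
  qed (auto simp: H_nil)
  then show ?thesis by (simp add: H_nil)
qed

text \<open>Corresponding trees are isomorphic by \<open>saturated_iso\<close>, so the type of the
  root depends on the sequence of values alone.\<close>

lemma forest_root_cong:
  assumes "\<And>n. saturated n (Q n)" "\<And>n. saturated n (Q' n)" "\<And>n. val n (Q n) = val n (Q' n)"
  shows "sat (forest Q') (\<lambda>_. Inr []) \<phi> = sat (forest Q) (\<lambda>_. Inr []) \<phi>"
proof -
  have "\<exists>h. tree_auto h \<and> (\<forall>l. length l = n \<longrightarrow> Q' n (h l) = Q n l)" for n
    using assms by (intro saturated_iso)
  then obtain h where "\<And>n. tree_auto (h n)" "\<And>n l. length l = n \<Longrightarrow> Q' n (h n l) = Q n l"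
    by metis
  then show ?thesis by (rule forest_iso)
qed

end

section \<open>Formulas evaluating the trees\<close>

text \<open>In these formulas the variable \<open>d\<close> stands for a node of depth \<open>d\<close>.\<close>

primrec val_fm :: "nat \<Rightarrow> nat \<Rightarrow> 'k fm" where
  "val_fm 0 d = Ex (Suc d) (Conj (Lt d (Var d) (Var (Suc d))) (Neg Bot))"
| "val_fm (Suc m) d = Ex (Suc d) (Conj (Lt d (Var d) (Var (Suc d))) (Neg (val_fm m (Suc d))))"

primrec chain_fm :: "nat \<Rightarrow> nat \<Rightarrow> 'k fm" where
  "chain_fm 0 d = Neg Bot"
| "chain_fm (Suc j) d = Ex (Suc d) (Conj (Lt d (Var d) (Var (Suc d))) (chain_fm j (Suc d)))"

text \<open>The two conditions on chains single out the child \<open>[n]\<close> of the root by the height of its tree.\<close>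

definition root_fm :: "nat \<Rightarrow> 'k fm" where
  "root_fm n = Ex 1 (Conj (Lt 0 (Var 0) (Var 1)) (Conj (chain_fm (Suc n) 1)
     (Conj (Neg (chain_fm (Suc (Suc n)) 1)) (val_fm n 1))))"

lemma val_fm_vars: "csts (val_fm m d) = {} \<and> fv (val_fm m d) \<subseteq> {d}"
  by (induction m arbitrary: d) auto

lemma chain_fm_vars: "csts (chain_fm m d) = {} \<and> fv (chain_fm m d) \<subseteq> {d}"
  by (induction m arbitrary: d) auto

lemma root_fm_vars: "csts (root_fm n) = {}" "fv (root_fm n) \<subseteq> {0}"
  using val_fm_vars[of n 1] chain_fm_vars[of "Suc n" 1] chain_fm_vars[of "Suc (Suc n)" 1]
  by (auto simp: root_fm_def)

context finite_models
begin

lemma sat_Ex_child: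
  assumes "v d = Inr l" "length l = d"
  shows "sat (forest Q) v (Ex (Suc d) (Conj (Lt d (Var d) (Var (Suc d))) \<phi>))
    \<longleftrightarrow> (\<exists>k. present Q (l @ [k]) \<and> sat (forest Q) (v(Suc d := Inr (l @ [k]))) \<phi>)"
    (is "?L \<longleftrightarrow> ?R")
proof
  assume ?L
  then obtain u where u: "rL (forest Q) d (Inr l) u" "sat (forest Q) (v(Suc d := u)) \<phi>"
    using assms(1) by (auto simp del: forest_simps)
  then obtain l' where l': "u = Inr l'" by (cases u) auto
  then obtain k where "l' = l @ [k]" using u(1) snoc_iff[of l' l] by auto
  then show ?R using u l' by auto
next
  assume ?R
  then obtain k where "present Q (l @ [k])" "sat (forest Q) (v(Suc d := Inr (l @ [k]))) \<phi>" by blast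
  then show ?L using assms by (auto intro!: bexI[of _ "Inr (l @ [k])"] simp: InrI)
qed

text \<open>\<open>m\<close> levels are left below the node \<open>n # l\<close>. At level
  \<open>0\<close> the formula asks for one more child, which is present exactly when the matrix
  holds there.\<close>

lemma sat_val_fm:
  assumes "v d = Inr (n # l)" "d = Suc (length l)" "m + length l = n"
  shows "sat (forest Q) v (val_fm m d) \<longleftrightarrow> val m (\<lambda>r. Q n (l @ r))"
  using assms
proof (induction m arbitrary: v d l)
  case 0
  then show ?case
    using sat_Ex_child[of v d "n # l" Q "Neg Bot"] by (simp add: butlast_append)
next
  case (Suc m)
  have "present Q (n # l @ [k])" for k using Suc.prems by simp
  moreover have "sat (forest Q) (v(Suc d := Inr (n # l @ [k]))) (val_fm m (Suc d))
      \<longleftrightarrow> val m (\<lambda>r. Q n ((l @ [k]) @ r))" for k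
    by (rule Suc.IH) (use Suc.prems in auto)
  moreover have "sat (forest Q) v (val_fm (Suc m) d)
      \<longleftrightarrow> (\<exists>k. present Q ((n # l) @ [k])
        \<and> sat (forest Q) (v(Suc d := Inr ((n # l) @ [k]))) (Neg (val_fm m (Suc d))))"
    unfolding val_fm.simps by (rule sat_Ex_child) (use Suc.prems in auto)
  ultimately show ?case
    by (simp only: sat.simps(5) append_Cons append_Nil append_assoc val.simps simp_thms)
qed

lemma sat_chain_fm:
  assumes "v d = Inr l" "d = length l" "present Q l"
  shows "sat (forest Q) v (chain_fm j d) \<longleftrightarrow> (\<exists>r. length r = j \<and> present Q (l @ r))"
  using assms
proof (induction j arbitrary: v d l)
  case 0
  then show ?case by simp
next
  case (Suc j)
  have "sat (forest Q) v (chain_fm (Suc j) d)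
      \<longleftrightarrow> (\<exists>k. present Q (l @ [k]) \<and> sat (forest Q) (v(Suc d := Inr (l @ [k]))) (chain_fm j (Suc d)))"
    unfolding chain_fm.simps using Suc.prems by (intro sat_Ex_child) auto
  also have "\<dots> \<longleftrightarrow> (\<exists>k. present Q (l @ [k]) \<and> (\<exists>r. length r = j \<and> present Q (l @ k # r)))"
  proof -
    have "sat (forest Q) (v(Suc d := Inr (l @ [k]))) (chain_fm j (Suc d))
        \<longleftrightarrow> (\<exists>r. length r = j \<and> present Q ((l @ [k]) @ r))" if "present Q (l @ [k])" for k
      by (rule Suc.IH) (use Suc.prems(2) that in auto)
    then show ?thesis by (intro ex_cong1 conj_cong) simp_all
  qed
  also have "\<dots> \<longleftrightarrow> (\<exists>r. length r = Suc j \<and> present Q (l @ r))"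
  proof -
    \<comment> \<open>Initial segments of present sequences are present, so the presence of the
      whole chain implies that of its first node.\<close>
    have "present Q l' \<Longrightarrow> present Q (take i l')" for l' i
    proof (induction l' rule: rev_induct)
      case (snoc x xs)
      then show ?case using present_snoc by (cases "i \<le> length xs") auto
    qed simp
    from this[of "l @ k # r" "Suc (length l)" for k r]
    have "present Q (l @ k # r) \<Longrightarrow> present Q (l @ [k])" for k r by simp
    then show ?thesis by (metis length_Suc_conv)
  qed
  finally show ?case .
qed

text \<open>The longest chain below \<open>[k]\<close> has length \<open>Suc k\<close> if tree
  \<open>k\<close> has a true leaf, and \<open>k\<close> otherwise. Saturation gives a true leaf
  whenever \<open>k > 0\<close>, so a longest chain of length \<open>Suc n\<close> forces
  \<open>k = n\<close>. If \<open>n = 0\<close> and tree \<open>0\<close> is false, no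
  \<open>k\<close> qualifies and both sides fail.\<close>

lemma sat_root_fm:
  assumes "\<And>n. saturated n (Q n)"
  shows "sat (forest Q) (\<lambda>_. Inr []) (root_fm n) \<longleftrightarrow> val n (Q n)"
proof -
  have chain: "(\<exists>r. length r = j \<and> present Q (k # r))
      \<longleftrightarrow> j \<le> k \<or> j = Suc k \<and> (\<exists>l. length l = k \<and> Q k l)" for j k
  proof -
    have "(\<exists>r. length r = Suc k \<and> Q k (butlast r)) \<longleftrightarrow> (\<exists>l. length l = k \<and> Q k l)"
      by (metis butlast_snoc length_append_singleton length_butlast diff_Suc_1)
    moreover have "\<exists>r::nat list. length r = j" by (rule exI[of _ "replicate j 0"]) simp
    ultimately show ?thesis by auto
  qed
  let ?v = "\<lambda>k. (\<lambda>_. Inr [])(Suc 0 := Inr [k])"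
  have "sat (forest Q) (\<lambda>_. Inr []) (root_fm n) \<longleftrightarrow>
      (\<exists>k. sat (forest Q) (?v k) (chain_fm (Suc n) 1)
         \<and> \<not> sat (forest Q) (?v k) (chain_fm (Suc (Suc n)) 1)
         \<and> sat (forest Q) (?v k) (val_fm n 1))"
  proof -
    define \<phi> where "\<phi> = Conj (chain_fm (Suc n) (Suc 0))
      (Conj (Neg (chain_fm (Suc (Suc n)) (Suc 0))) (val_fm n (Suc 0)) :: 'k fm)"
    have "sat (forest Q) (\<lambda>_. Inr []) (root_fm n) \<longleftrightarrow> (\<exists>k. present Q ([] @ [k])
        \<and> sat (forest Q) ((\<lambda>_. Inr [])(Suc 0 := Inr ([] @ [k]))) \<phi>)"
      unfolding root_fm_def One_nat_def \<phi>_def by (rule sat_Ex_child) simp_all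
    then show ?thesis
      by (simp only: \<phi>_def sat.simps append_Nil present_simps list.size le0 simp_thms One_nat_def)
  qed
  also have "\<dots> \<longleftrightarrow> (\<exists>k. (Suc n \<le> k \<or> n = k \<and> (\<exists>l. length l = k \<and> Q k l))
      \<and> \<not> (Suc (Suc n) \<le> k \<or> Suc n = k \<and> (\<exists>l. length l = k \<and> Q k l))
      \<and> sat (forest Q) (?v k) (val_fm n 1))"
  proof -
    have "sat (forest Q) (?v k) (chain_fm j 1)
        \<longleftrightarrow> j \<le> k \<or> j = Suc k \<and> (\<exists>l. length l = k \<and> Q k l)" for j k
      using sat_chain_fm[of "?v k" 1 "[k]" Q j] chain[of j k] by simp
    then show ?thesis by (simp only: nat.inject)
  qed
  also have "\<dots> \<longleftrightarrow> val n (Q n)"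
  proof -
    \<comment> \<open>Excludes \<open>k = Suc n\<close>: that tree has a true leaf and hence a chain
      that is too long.\<close>
    have "\<exists>l. length l = Suc n \<and> Q (Suc n) l"
      using saturated_ex_true[OF assms] by blast
    then have k: "k = n" if "Suc n \<le> k \<or> n = k \<and> (\<exists>l. length l = k \<and> Q k l)"
      "\<not> (Suc (Suc n) \<le> k \<or> Suc n = k \<and> (\<exists>l. length l = k \<and> Q k l))" for k
      using that by (cases "k = Suc n") auto
    have val: "sat (forest Q) (?v n) (val_fm n 1) \<longleftrightarrow> val n (Q n)"
      using sat_val_fm[of "?v n" 1 n "[]" n Q] by simp
    show ?thesis
    proof
      assume "val n (Q n)"
      moreover from this have "\<exists>l. length l = n \<and> Q n l"
        using saturated_ex_true[OF assms] by blast
      ultimately show "\<exists>k. (Suc n \<le> k \<or> n = k \<and> (\<exists>l. length l = k \<and> Q k l))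
          \<and> \<not> (Suc (Suc n) \<le> k \<or> Suc n = k \<and> (\<exists>l. length l = k \<and> Q k l))
          \<and> sat (forest Q) (?v k) (val_fm n 1)"
        using val by (intro exI[of _ n] conjI) auto
    next
      assume "\<exists>k. (Suc n \<le> k \<or> n = k \<and> (\<exists>l. length l = k \<and> Q k l))
          \<and> \<not> (Suc (Suc n) \<le> k \<or> Suc n = k \<and> (\<exists>l. length l = k \<and> Q k l))
          \<and> sat (forest Q) (?v k) (val_fm n 1)"
      then obtain k where "k = n" "sat (forest Q) (?v k) (val_fm n 1)" using k by blast
      then show "val n (Q n)" using val by simp
    qed
  qed
  finally show ?thesis .
qed

section \<open>Copies on the natural numbers and the type\<close>

definition nth_elem :: "nat \<Rightarrow> 'k + nat list" where
  "nth_elem = from_nat_into (all_csts C <+> UNIV)"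

definition index :: "'k + nat list \<Rightarrow> nat" where
  "index = to_nat_on (all_csts C <+> UNIV)"

text \<open>The numbering of the elements is the same for all \<open>Q\<close>, so that an atomic
  fact about given numbers is finitary in the matrices.\<close>

definition nat_forest :: "(nat \<Rightarrow> nat list \<Rightarrow> bool) \<Rightarrow> ('k, nat) struct" where
  "nat_forest Q = \<lparr>univ = UNIV, rP = \<lambda>i x. rP (forest Q) i (nth_elem x),
     rL = \<lambda>i x y. rL (forest Q) i (nth_elem x) (nth_elem y), cst = \<lambda>c. index (cst (forest Q) c)\<rparr>"

lemma nat_forest_simps [simp]:
  "univ (nat_forest Q) = UNIV"
  "rP (nat_forest Q) i x = rP (forest Q) i (nth_elem x)"
  "rL (nat_forest Q) i x y = rL (forest Q) i (nth_elem x) (nth_elem y)"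
  "cst (nat_forest Q) c = index (if c \<in> all_csts C then Inl c else Inr [])"
  by (simp_all add: nat_forest_def)

lemma is_struct_nat_forest: "is_struct K (nat_forest Q)"
  by (simp add: is_struct_def)

lemma elems: "countable (all_csts C <+> (UNIV :: nat list set))"
    "infinite (all_csts C <+> (UNIV :: nat list set))"
  using countable by (simp_all add: finite_Plus_iff infinite_UNIV_listI)

lemma nth_elem_index: "u \<in> all_csts C <+> UNIV \<Longrightarrow> nth_elem (index u) = u"
  using elems by (simp add: nth_elem_def index_def)

lemma sat_nat_forest: "sat (forest Q) (\<lambda>x. nth_elem (v x)) \<phi> = sat (nat_forest Q) v \<phi>"
proof (rule sat_iso)
  show "bij_betw nth_elem (univ (nat_forest Q)) (univ (forest Q))"
    using bij_betw_from_nat_into[OF elems] by (simp add: nth_elem_def)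
qed (auto simp: nth_elem_index InlI InrI)

lemma sat_nat_forest_root: "sat (nat_forest Q) (\<lambda>_. index (Inr [])) \<phi> = sat (forest Q) (\<lambda>_. Inr []) \<phi>"
  using sat_nat_forest[of Q "\<lambda>_. index (Inr [])" \<phi>] by (simp add: nth_elem_index InrI)

section \<open>The type of the root\<close>

definition root_type :: "'k fm set" where
  "root_type = {\<phi>. csts \<phi> \<subseteq> all_csts C \<and> fv \<phi> \<subseteq> {0}
     \<and> sat (forest (\<lambda>_. canonical True)) (\<lambda>_. Inr []) \<phi>}"

lemma root_type_complete: "root_type \<in> complete_1_types (all_csts C) (theory_T M C e)"
proof -
  let ?N = "nat_forest (\<lambda>_. canonical True)" and ?v = "\<lambda>_::nat. index (Inr [])"
  have "sat ?N ?v \<phi>" if "\<phi> \<in> theory_T M C e \<union> root_type" for \<phi>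
  proof (cases "\<phi> \<in> root_type")
    case True
    then show ?thesis by (simp add: sat_nat_forest_root root_type_def)
  next
    case False
    then have "holds (forest (\<lambda>_. canonical True)) \<phi>" using that forest_theory_T by blast
    then have "sat (forest (\<lambda>_. canonical True)) (\<lambda>_. Inr []) \<phi>"
      unfolding holds_def by (auto simp: InrI)
    then show ?thesis by (simp only: sat_nat_forest_root)
  qed
  then have "\<exists>(N :: ('k, nat) struct) v. is_struct (all_csts C) N \<and> range v \<subseteq> univ N
      \<and> (\<forall>\<phi> \<in> theory_T M C e \<union> root_type. sat N v \<phi>)"
    using is_struct_nat_forest by (intro exI[of _ ?N] exI[of _ ?v]) simp
  then show ?thesis
    unfolding complete_1_types_def by (auto simp: root_type_def)
qed

text \<open>The formulas \<open>root_fm n\<close> belong to the type and express the values;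
  conversely, the values determine the type of the root. The root is named by \<open>a\<close>,
  which lies outside \<open>all_csts C\<close>.\<close>

lemma models_root_type:
  assumes "a \<notin> all_csts C" "\<And>n. saturated n (Q n)"
  shows "models (nat_forest Q) (type_at root_type a) \<longleftrightarrow> (\<forall>n. val n (Q n))"
proof -
  have "models (nat_forest Q) (type_at root_type a) \<longleftrightarrow>
      (\<forall>\<phi>\<in>root_type. sat (forest Q) (\<lambda>_. Inr []) \<phi>)"
  proof -
    have "root_type \<subseteq> {\<phi>. csts \<phi> \<subseteq> all_csts C \<and> fv \<phi> \<subseteq> {0}}"
      by (auto simp: root_type_def)
    from models_type_at[OF this is_struct_nat_forest, of Q a] assms(1) show ?thesis
      by (simp add: sat_nat_forest_root)
  qed
  also have "\<dots> \<longleftrightarrow> (\<forall>n. val n (Q n))"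
  proof
    assume *: "\<forall>\<phi>\<in>root_type. sat (forest Q) (\<lambda>_. Inr []) \<phi>"
    have "root_fm n \<in> root_type" for n
      by (simp add: root_fm_vars root_type_def sat_root_fm saturated_canonical val_canonical)
    then show "\<forall>n. val n (Q n)" using * sat_root_fm[OF assms(2)] by blast
  next
    assume "\<forall>n. val n (Q n)"
    then have "sat (forest Q) (\<lambda>_. Inr []) \<phi> = sat (forest (\<lambda>_. canonical True)) (\<lambda>_. Inr []) \<phi>" for \<phi>
      using assms(2) by (intro forest_root_cong) (simp_all add: saturated_canonical val_canonical)
    then show "\<forall>\<phi>\<in>root_type. sat (forest Q) (\<lambda>_. Inr []) \<phi>"
      by (simp add: root_type_def)
  qed
  finally show ?thesis .
qed

end

section \<open>Complexity of satisfaction in a family of structures\<close>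

text \<open>A quantifier-free formula consults finitely many atomic facts, the same ones for all
  \<open>x\<close> because the constants do not move.\<close>

lemma finitary_sat_qfree:
  assumes "\<And>i u. finitary (\<lambda>x. rP (N x) i u)" "\<And>i u w. finitary (\<lambda>x. rL (N x) i u w)"
    and c: "\<And>x. cst (N x) = c" and "qfree \<phi>"
  shows "finitary (\<lambda>x. sat (N x) v \<phi>)"
proof -
  have t: "tval (N x) v t = (case t of Var y \<Rightarrow> v y | Cst k \<Rightarrow> c k)" for x t
    by (cases t) (simp_all add: c)
  show ?thesis
    using \<open>qfree \<phi>\<close>
    by (induction \<phi>) (auto simp: t assms(1,2) intro: finitary_not finitary_conj finitary_disj)
qed

text \<open>\<open>assign xs us v\<close> overwrites \<open>v\<close> on \<open>xs\<close>, with junk values where \<open>us\<close> is too short.\<close>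

primrec assign :: "nat list \<Rightarrow> nat list \<Rightarrow> (nat \<Rightarrow> nat) \<Rightarrow> nat \<Rightarrow> nat" where
  "assign [] us v = v"
| "assign (x # xs) us v = assign xs (tl us) (v(x := hd us))"

text \<open>A block of any length becomes a single quantifier over codes of lists, and so costs one
  level of \<open>Sig\<close>.\<close>

lemma sat_block:
  fixes N :: "('k, nat) struct"
  assumes "univ N = UNIV"
  shows "sat N v (foldr Ex xs \<psi>) \<longleftrightarrow> (\<exists>k. sat N (assign xs (list_decode k) v) \<psi>)"
    and "sat N v (foldr All xs \<psi>) \<longleftrightarrow> (\<forall>k. sat N (assign xs (list_decode k) v) \<psi>)"
proof -
  have "sat N v (foldr Ex xs \<psi>) \<longleftrightarrow> (\<exists>us. sat N (assign xs us v) \<psi>)" for v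
  proof (induction xs arbitrary: v)
    case (Cons x xs)
    have "sat N v (foldr Ex (x # xs) \<psi>) \<longleftrightarrow> (\<exists>u us. sat N (assign xs us (v(x := u))) \<psi>)"
      using assms Cons by (simp add: fun_upd_def)
    also have "\<dots> \<longleftrightarrow> (\<exists>us. sat N (assign (x # xs) us v) \<psi>)"
      by (metis assign.simps(2) list.sel(1,3))
    finally show ?case .
  qed simp
  then show "sat N v (foldr Ex xs \<psi>) \<longleftrightarrow> (\<exists>k. sat N (assign xs (list_decode k) v) \<psi>)"
    by (metis list_encode_inverse)
  have "sat N v (foldr All xs \<psi>) \<longleftrightarrow> (\<forall>us. sat N (assign xs us v) \<psi>)" for v
  proof (induction xs arbitrary: v)
    case (Cons x xs)
    have "sat N v (foldr All (x # xs) \<psi>) \<longleftrightarrow> (\<forall>u us. sat N (assign xs us (v(x := u))) \<psi>)"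
      using assms Cons by (simp add: fun_upd_def)
    also have "\<dots> \<longleftrightarrow> (\<forall>us. sat N (assign (x # xs) us v) \<psi>)"
      by (metis assign.simps(2) list.sel(1,3))
    finally show ?case .
  qed simp
  then show "sat N v (foldr All xs \<psi>) \<longleftrightarrow> (\<forall>k. sat N (assign xs (list_decode k) v) \<psi>)"
    by (metis list_encode_inverse)
qed

text \<open>Universal formulas enter through their failure, because each level of \<open>Sig\<close>
  begins with an existential quantifier; the negation in \<open>SigI\<close> exchanges the two
  halves of the induction.\<close>

lemma Sig_sat:
  fixes N :: "('a \<Rightarrow> bool) \<Rightarrow> ('k, nat) struct"
  assumes "\<And>x. univ (N x) = UNIV"
    and "\<And>\<phi> v. qfree \<phi> \<Longrightarrow> finitary (\<lambda>x. sat (N x) v \<phi>)"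
  shows "(\<phi> \<in> forall_fms n \<longrightarrow> (\<lambda>x. \<not> sat (N x) v \<phi>) \<in> Sig n)
    \<and> (\<phi> \<in> exists_fms n \<longrightarrow> (\<lambda>x. sat (N x) v \<phi>) \<in> Sig n)"
proof (induction n arbitrary: \<phi> v)
  case 0
  then show ?case using assms(2) by (auto intro: finitary_not)
next
  case (Suc n)
  have "(\<lambda>x. \<not> sat (N x) v \<phi>) \<in> Sig (Suc n)" if "\<phi> \<in> forall_fms (Suc n)"
  proof -
    obtain xs \<psi> where \<phi>: "\<phi> = foldr All xs \<psi>" "\<psi> \<in> exists_fms n" using \<open>\<phi> \<in> _\<close> by auto
    then have "(\<lambda>x. \<exists>k. \<not> sat (N x) (assign xs (list_decode k) v) \<psi>) \<in> Sig (Suc n)"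
      using Suc.IH by (intro SigI) blast
    then show ?thesis by (simp add: \<phi>(1) sat_block[OF assms(1)])
  qed
  moreover have "(\<lambda>x. sat (N x) v \<phi>) \<in> Sig (Suc n)" if "\<phi> \<in> exists_fms (Suc n)"
  proof -
    obtain xs \<psi> where \<phi>: "\<phi> = foldr Ex xs \<psi>" "\<psi> \<in> forall_fms n" using \<open>\<phi> \<in> _\<close> by auto
    then have "(\<lambda>x. \<exists>k. \<not> \<not> sat (N x) (assign xs (list_decode k) v) \<psi>) \<in> Sig (Suc n)"
      using Suc.IH by (intro SigI) blast
    then show ?thesis by (simp add: \<phi>(1) sat_block[OF assms(1)])
  qed
  ultimately show ?case by blast
qed

text \<open>Failure of the set is failure of one of countably many sentences, a countable union of
  \<open>Sig n\<close> predicates.\<close>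

lemma Sig_not_models:
  fixes N :: "('a \<Rightarrow> bool) \<Rightarrow> ('k, nat) struct"
  assumes "\<And>x. univ (N x) = UNIV"
    and "\<And>\<phi> v. qfree \<phi> \<Longrightarrow> finitary (\<lambda>x. sat (N x) v \<phi>)"
    and "countable K" "\<Gamma> \<subseteq> sentences K \<inter> forall_fms n"
  shows "(\<lambda>x. \<not> models (N x) \<Gamma>) \<in> Sig (Suc (Suc n))"
\<comment> \<open>\<open>from_nat_into\<close> enumerates only nonempty sets.\<close>
proof (cases "\<Gamma> = {}")
  case True
  then have "(\<lambda>x. \<not> models (N x) \<Gamma>) = (\<lambda>x. False)" by (simp add: models_def)
  then show ?thesis by (simp only: Sig_const)
next
  case False
  have "\<Gamma> \<subseteq> {\<phi>. csts \<phi> \<subseteq> K}" using assms(4) by (auto simp: sentences_def)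
  then have cnt: "countable \<Gamma>" using countable_fms[OF assms(3)] countable_subset by blast
  have holds: "holds (N x) \<phi> \<longleftrightarrow> sat (N x) (\<lambda>_. 0) \<phi>" if "\<phi> \<in> \<Gamma>" for x \<phi>
    using that assms(1,4) by (intro holds_sentence) (auto simp: sentences_def)
  have "(\<lambda>x. \<exists>k. \<not> sat (N x) (\<lambda>_. 0) (from_nat_into \<Gamma> k)) \<in> Sig (Suc (Suc n))"
    using Sig_sat[OF assms(1,2)] assms(4) from_nat_into[OF False] by (intro Sig_union) blast
  moreover have "models (N x) \<Gamma> \<longleftrightarrow> (\<forall>k. sat (N x) (\<lambda>_. 0) (from_nat_into \<Gamma> k))" for x
    unfolding models_def
    using holds from_nat_into[OF False] from_nat_into_surj[OF cnt] by metis
  ultimately show ?thesis by simp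
qed

section \<open>Atomic diagrams\<close>

text \<open>All elements have names, so the diagram determines the relations and, through equations
  with names, the constants of \<open>K\<close>. The identity is then an isomorphism.\<close>

lemma sat_diagram_cong:
  fixes N N' :: "('k, nat) struct"
  assumes enum: "enumerates_atomic_sentences enum K"
    and univ: "univ N = UNIV" "univ N' = UNIV"
    and diag: "atomic_diagram enum N = atomic_diagram enum N'" and "csts \<phi> \<subseteq> K"
  shows "sat N v \<phi> \<longleftrightarrow> sat N' v \<phi>"
proof -
  have h: "holds (name_elements N) \<psi> \<longleftrightarrow> holds (name_elements N') \<psi>"
    if "\<psi> \<in> atomic_sentences (Inl ` K \<union> range Inr)" for \<psi>
  proof -
    have "\<psi> \<in> range enum"
      using that enum by (simp only: enumerates_atomic_sentences_def)
    then obtain k where "\<psi> = enum k" by (rule rangeE)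
    then show ?thesis using fun_cong[OF diag, of k] by (simp add: atomic_diagram_def)
  qed
  have P: "rP N i x \<longleftrightarrow> rP N' i x" for i x
    using h[of "Pr i (Cst (Inr x))"] univ
    by (auto simp: atomic_sentences_def sentences_def holds_def name_elements_def)
  have L: "rL N i x y \<longleftrightarrow> rL N' i x y" for i x y
    using h[of "Lt i (Cst (Inr x)) (Cst (Inr y))"] univ
    by (auto simp: atomic_sentences_def sentences_def holds_def name_elements_def)
  have c: "cst N' c = cst N c" if "c \<in> K" for c
    using h[of "Eq (Cst (Inl c)) (Cst (Inr (cst N c)))"] univ that
    by (auto simp: atomic_sentences_def sentences_def holds_def name_elements_def)
  have "sat N' (\<lambda>x. v x) \<phi> = sat N v \<phi>"
  proof (rule sat_iso[where h = "\<lambda>x. x"])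
    show "cst N c \<in> univ N \<and> cst N' c = cst N c" if "c \<in> csts \<phi>" for c
      using that c \<open>csts \<phi> \<subseteq> K\<close> univ by auto
  qed (simp_all add: univ P L bij_betw_def)
  then show ?thesis by simp
qed

lemma finitary_atomic_diagram:
  fixes N :: "('a \<Rightarrow> bool) \<Rightarrow> ('k, nat) struct"
  assumes enum: "enumerates_atomic_sentences enum K" and univ: "\<And>x. univ (N x) = UNIV"
    and "\<And>i u. finitary (\<lambda>x. rP (N x) i u)" "\<And>i u w. finitary (\<lambda>x. rL (N x) i u w)"
    and c: "\<And>x. cst (N x) = c"
  shows "finitary (\<lambda>x. atomic_diagram enum (N x) n)"
proof -
  have "enum n \<in> atomic_sentences (Inl ` K \<union> range Inr)"
    using enum unfolding enumerates_atomic_sentences_def by auto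
  then have "fv (enum n) = {}" "qfree (enum n)"
    by (auto simp: atomic_sentences_def sentences_def elim: atomic.elims)
  then have "atomic_diagram enum (N x) n = sat (name_elements (N x)) (\<lambda>_. 0) (enum n)" for x
    using univ by (simp add: atomic_diagram_def holds_sentence[of _ "\<lambda>_. 0"] name_elements_def)
  moreover have "finitary (\<lambda>x. sat (name_elements (N x)) (\<lambda>_. 0) (enum n))"
    using assms(3,4) c \<open>qfree (enum n)\<close>
    by (intro finitary_sat_qfree[where c = "case_sum c id"]) (auto simp: name_elements_def)
  ultimately show ?thesis by simp
qed

text \<open>The equations \<open>c = c\<close> are all listed and differ for different
  \<open>c\<close>.\<close>

lemma countable_enumerated:
  assumes "enumerates_atomic_sentences enum K"
  shows "countable K"
proof -
  have "(\<lambda>c. Eq (Cst (Inl c)) (Cst (Inl c))) ` K \<subseteq> range enum"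
    using assms by (auto simp: enumerates_atomic_sentences_def atomic_sentences_def sentences_def)
  then have "countable ((\<lambda>c. Eq (Cst (Inl c :: _ + nat)) (Cst (Inl c))) ` K)"
    by (rule countable_subset) simp
  then show ?thesis by (rule countable_image_inj_on) (auto simp: inj_on_def)
qed

section \<open>Hardness and failure of axiomatizability\<close>

context finite_models
begin

lemma finitary_nat_forest:
  assumes "\<And>n l. finitary (\<lambda>x. Q x n l)"
  shows "finitary (\<lambda>x. rP (nat_forest (Q x)) i u)" "finitary (\<lambda>x. rL (nat_forest (Q x)) i u w)"
proof -
  have present: "finitary (\<lambda>x. present (Q x) l)" for l
    by (cases l) (auto intro!: finitary_disj finitary_conj assms)
  show "finitary (\<lambda>x. rP (nat_forest (Q x)) i u)"
    by (cases "nth_elem u") (auto intro!: finitary_conj present)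
  show "finitary (\<lambda>x. rL (nat_forest (Q x)) i u w)"
    by (cases "nth_elem u"; cases "nth_elem w") (auto intro!: finitary_conj present)
qed

lemma cst_nat_forest: "cst (nat_forest Q) = cst (nat_forest (\<lambda>_ _. True))"
  by (simp add: nat_forest_def)

lemma root_type_hard:
  assumes a: "a \<notin> all_csts C" and enum: "enumerates_atomic_sentences enum (insert a (all_csts C))"
  shows "Pi0_omega_hard (Mod enum (insert a (all_csts C)) (type_at root_type a))"
  unfolding Pi0_omega_hard_def
proof (intro allI impI)
  fix B assume "Pi0_omega B"
  then obtain S R where B: "B = (\<Inter>i\<in>{0<..}. S i)"
    and S: "\<And>i. i > 0 \<Longrightarrow> S i = {f. alternating True i (\<lambda>ks. R (list_encode (i # map (restr_code f) ks)))}"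
    unfolding Pi0_omega_def uniformly_Sigma_def by metis
  \<comment> \<open>The parity is that of \<open>alternating_val\<close>. Index \<open>0\<close>
    lies outside the intersection, so tree \<open>0\<close> is made true.\<close>
  define Q where "Q x i ks \<longleftrightarrow> i = 0 \<or> R (list_encode (i # map (restr_code x) ks)) = even i" for x i ks
  define N where "N x = nat_forest (\<lambda>i l. pad l (Q x i))" for x
  define f where "f x = atomic_diagram enum (N x)" for x
  have "x \<in> B \<longleftrightarrow> (\<forall>i. val i (Q x i))" for x
  proof -
    have "val i (Q x i) \<longleftrightarrow> x \<in> S i" if "i > 0" for i
    proof -
      have "Q x i = (\<lambda>ks. R (list_encode (i # map (restr_code x) ks)) = even i)"
        using that by (intro ext) (simp add: Q_def)
      then show ?thesis using S[OF that] by (simp only: alternating_val mem_Collect_eq)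
    qed
    moreover have "val 0 (Q x 0)" by (simp add: Q_def)
    ultimately show ?thesis unfolding B by (metis INT_iff greaterThan_iff gr0I)
  qed
  then have B_iff: "x \<in> B \<longleftrightarrow> models (N x) (type_at root_type a)" for x
    using models_root_type[OF a, of "\<lambda>i l. pad l (Q x i)"]
    by (simp add: N_def val_saturated_pad)
  have fin_Q: "finitary (\<lambda>x. Q x i ks)" for i ks
  \<comment> \<open>The matrix at \<open>ks\<close> reads \<open>x\<close> only below the largest
    entry of \<open>ks\<close>; \<open>0\<close> is inserted for the empty list.\<close>
  proof (rule finitaryI[of "{..<Max (insert 0 (set ks))}"])
    fix x y :: "nat \<Rightarrow> bool"
    assume eq: "\<And>m. m \<in> {..<Max (insert 0 (set ks))} \<Longrightarrow> x m = y m"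
    have "restr_code x k = restr_code y k" if "k \<in> set ks" for k
    proof -
      have "k \<le> Max (insert 0 (set ks))" using that by simp
      then show ?thesis using eq by (auto simp: restr_code_def intro!: arg_cong[of _ _ list_encode])
    qed
    then have "map (restr_code x) ks = map (restr_code y) ks" by simp
    then show "Q x i ks = Q y i ks" by (simp only: Q_def)
  qed simp
  have "finitary (\<lambda>x. f x n)" for n
    unfolding f_def
  proof (rule finitary_atomic_diagram[OF enum])
    show "univ (N x) = UNIV" for x by (simp add: N_def)
    show "cst (N x) = cst (nat_forest (\<lambda>_ _. True))" for x unfolding N_def by (rule cst_nat_forest)
    have "finitary (\<lambda>x. pad l (Q x i))" for i l by (rule finitary_pad) (rule fin_Q)
    note fin = finitary_nat_forest[OF this]
    show "finitary (\<lambda>x. rP (N x) i u)" for i u unfolding N_def by (rule fin(1))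
    show "finitary (\<lambda>x. rL (N x) i u w)" for i u w unfolding N_def by (rule fin(2))
  qed
  then have cont: "continuous_on UNIV f"
    by (intro continuous_on_coordinatewise_then_product continuous_on_finitary)
  have "f x \<in> Mod enum (insert a (all_csts C)) (type_at root_type a) \<longleftrightarrow> x \<in> B" for x
  proof
    assume "x \<in> B"
    then show "f x \<in> Mod enum (insert a (all_csts C)) (type_at root_type a)"
      unfolding Mod_def f_def
      by (intro imageI) (simp add: B_iff[symmetric], simp add: N_def is_struct_nat_forest)
  next
    \<comment> \<open>The model witnessing membership may differ from \<open>N x\<close>, but it
      shares its diagram, and the diagram decides every sentence of
      \<open>type_at root_type a\<close>.\<close>
    assume "f x \<in> Mod enum (insert a (all_csts C)) (type_at root_type a)"
    then obtain N' where N': "is_struct (insert a (all_csts C)) N'" "univ N' = UNIV"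
      "models N' (type_at root_type a)" "atomic_diagram enum (N x) = atomic_diagram enum N'"
      unfolding Mod_def f_def by auto
    have "csts (inst 0 a \<phi>) \<subseteq> insert a (csts \<phi>)" for \<phi> :: "'k fm"
    proof -
      have "set_tm (inst_tm y a t) \<subseteq> insert a (set_tm t)" for y and t :: "'k tm"
        by (cases t) auto
      then show ?thesis by (induction \<phi>) (auto; blast)+
    qed
    then have csts: "csts \<psi> \<subseteq> insert a (all_csts C)" if "\<psi> \<in> type_at root_type a" for \<psi>
      using that by (fastforce simp: type_at_def root_type_def)
    have univ: "univ (N x) = UNIV" by (simp add: N_def)
    have "holds (N x) \<psi>" if "\<psi> \<in> type_at root_type a" for \<psi>
      using N'(3) that sat_diagram_cong[OF enum univ N'(2,4) csts[OF that]]
      by (simp add: models_def holds_def N'(2) univ)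
    then show "x \<in> B" by (simp add: B_iff models_def)
  qed
  then show "\<exists>f. continuous_on UNIV f
      \<and> f -` Mod enum (insert a (all_csts C)) (type_at root_type a) = B"
    using cont by (intro exI[of _ f]) auto
qed

lemma root_type_not_forall_axiomatizable:
  assumes a: "a \<notin> all_csts C"
  shows "\<not> forall_axiomatizable n (insert a (all_csts C)) (type_at root_type a)"
proof
  let ?K = "insert a (all_csts C)" and ?m = "Suc (Suc n)"
  assume "forall_axiomatizable n ?K (type_at root_type a)"
  then obtain \<Gamma> where \<Gamma>: "\<Gamma> \<subseteq> sentences ?K \<inter> forall_fms n"
    and ax: "\<And>N :: ('k, nat) struct. is_struct ?K N
      \<Longrightarrow> models N \<Gamma> \<longleftrightarrow> models N (type_at root_type a)"
    unfolding forall_axiomatizable_def by blast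
  \<comment> \<open>All trees but the one of height \<open>?m\<close> are true, so being a model
    amounts to the truth of \<open>q\<close>; \<open>?m\<close> is the level given by
    \<open>Sig_not_models\<close>.\<close>
  define Q where "Q q i = (if i = ?m then \<lambda>l. pad l q else canonical True)"
    for q :: "nat list \<Rightarrow> bool" and i
  define N where "N q = nat_forest (Q q)" for q
  have Q: "saturated i (Q q i)" "val i (Q q i) \<longleftrightarrow> i = ?m \<longrightarrow> val i q" for q i
    using val_saturated_pad[of i q]
    by (cases "i = ?m"; simp add: Q_def saturated_canonical val_canonical del: val.simps saturated.simps)+
  have "models (N q) \<Gamma> \<longleftrightarrow> val ?m q" for q
  proof -
    have "models (N q) \<Gamma> \<longleftrightarrow> models (N q) (type_at root_type a)"
      unfolding N_def by (rule ax[OF is_struct_nat_forest])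
    also have "\<dots> \<longleftrightarrow> (\<forall>i. val i (Q q i))"
      unfolding N_def by (rule models_root_type[OF a Q(1)])
    finally show ?thesis by (simp only: Q(2)) blast
  qed
  moreover have "(\<lambda>q. \<not> models (N q) \<Gamma>) \<in> Sig ?m"
  proof (rule Sig_not_models[OF _ _ _ \<Gamma>])
    show "univ (N q) = UNIV" for q by (simp add: N_def)
    show "countable ?K" using countable by simp
    have "finitary (\<lambda>q. Q q i l)" for i l
    proof (cases "i = ?m")
      case True
      then show ?thesis using finitary_pad[of "\<lambda>q. q" l] by (auto simp: Q_def)
    next
      case False
      then show ?thesis by (auto simp: Q_def)
    qed
    note fin = finitary_nat_forest[OF this]
    show "finitary (\<lambda>q. sat (N q) v \<phi>)" if "qfree \<phi>" for v \<phi>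
      unfolding N_def by (rule finitary_sat_qfree[OF fin cst_nat_forest that])
  qed
  ultimately show False using not_Sig_not_val[of "Suc n"] by (simp del: val.simps Sig.simps)
qed

end

theorem theorem7p8:
  fixes M :: "nat \<Rightarrow> ('k, 'u) struct"
    and C :: "nat \<Rightarrow> nat \<Rightarrow> 'k set"
    and e :: "nat \<Rightarrow> nat \<Rightarrow> 'k \<Rightarrow> 'u"
    and a :: 'k
    and enum :: "nat \<Rightarrow> ('k + nat) fm"
  assumes "lists_finite_T0_models M"
    and "\<And>i j i' j'. (i, j) \<noteq> (i', j') \<Longrightarrow> C i j \<inter> C i' j' = {}"
    and "\<And>i j. bij_betw (e i j) (C i j) (univ (M i))"
    and "a \<notin> all_csts C"
    and "enumerates_atomic_sentences enum (insert a (all_csts C))"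
  shows "\<exists>p \<in> complete_1_types (all_csts C) (theory_T M C e).
           Pi0_omega_hard (Mod enum (insert a (all_csts C)) (type_at p a))
         \<and> (\<forall>n. \<not> forall_axiomatizable n (insert a (all_csts C)) (type_at p a))"
proof -
  have "countable (all_csts C)"
    using countable_enumerated[OF assms(5)] by simp
  then interpret finite_models M C e
    using assms(1-3) by unfold_locales (auto simp: lists_finite_T0_models_def)
  show ?thesis
    using root_type_complete root_type_hard[OF assms(4,5)]
      root_type_not_forall_axiomatizable[OF assms(4)] by blast
qed

end
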